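(* Let $\boldsymbol{\delta}$ be the solution of $\boldsymbol{\delta}_{tt}=Q\boldsymbol{\delta}+\mathbf{T}_{\boldsymbol\delta}$ with zero initial data, where $Q$ is the FD-DG semidiscretization operator built from the SBP operator of order $(4,2)$ and discontinuous Galerkin with cubic polynomials (given explicitly in the context), and $\mathbf{T}_{\boldsymbol\delta}$ is the truncation error at the eight nodes at the FD-DG interface, equal to $\mathbf{T}_\Gamma$ there and zero at all other nodes. Then $$\sqrt{\int_0^T\|\boldsymbol\delta\|_h^2\,dt}\le Ch^4,$$ where $C$ is a constant independent of $h$ that depends on the final time $T$ and the fourth derivative of the true solution $U$ at the interface $x=0$.
   Context: The true solution $U$ solves $U_{tt}=U_{xx}$, $x\in(-\infty,\infty)$, $t\in(0,T]$, with smooth initial data of bounded support. Nodes. Finite difference (FD) side: $x_j=-(j-1)h$, $j=1,2,\dots$. Discontinuous Galerkin (DG) side: elements $I_j=(X_j,X_{j+1})$ with $X_j=(j-1)h$, $j=1,2,\dots$, and on each element the four Lagrange nodes $X_j+(i-1)h/3$, $i=1,2,3,4$ (so nodes are duplicated at inter-element points). A grid vector has one component per FD node and four components per DG element: $\mathbf{z}=[\mathbf{w};\mathbf{u}]$. The DG components are the nodal values of a piecewise cubic polynomial. The operator $Q$. (i) At $x_j$, $j\ge5$: $(Q\mathbf{z})_j=\frac1{h^2}\left(-\frac1{12}w_{j-2}+\frac43w_{j-1}-\frac52w_j+\frac43w_{j+1}-\frac1{12}w_{j+2}\right)$. (ii) On element $j\ge2$: the four components of $Q\mathbf{z}$ are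 obtained by applying to the 12 nodal values of elements $j-1,j,j+1$ (left to right) the matrix $$\frac{1}{h^2}\left[\begin{array}{cccccccccccc} 8&-36&72&296&-368&36&-18&80&-59&-18&9&-2\\ -\frac{34}{27}&\frac{17}{3}&-\frac{34}{3}&-\frac{943}{27}&\frac{1576}{27}&-32&20&-\frac{622}{27}&\frac{412}{27}&\frac{16}{3}&-\frac83&\frac{16}{27}\\ \frac{16}{27}&-\frac83&\frac{16}{3}&\frac{412}{27}&-\frac{622}{27}&20&-32&\frac{1576}{27}&-\frac{943}{27}&-\frac{34}{3}&\frac{17}{3}&-\frac{34}{27}\\ -2&9&-18&-59&80&-18&36&-368&296&72&-36&8 \end{array}\right].$$ (iii) At the eight interface nodes $x_4,x_3,x_2,x_1$ and the four nodes of element $I_1$ (left to right), the components of $Q\mathbf{z}$ are obtained by applying to the 14 values at $x_6,x_5,x_4,x_3,x_2,x_1$, the four nodes of $I_1$ and the four nodes of $I_2$ the matrix $$\frac1{h^2}\left[\begin{array}{cccccccccccccc} -\frac4{49}&\frac{64}{49}&-\frac{118}{49}&\frac{59}{49}&0&-\frac9{49}&\frac8{49}&0&0&0&0&0&0&0\\ 0&-\frac4{43}&\frac{59}{43}&-\frac{110}{43}&\frac{59}{43}&\frac{32}{43}&-\frac{36}{43}&0&0&0&0&0&0&0\\ 0&0&0&1&-2&-\frac{13}{59}&\frac{72}{59}&0&0&0&0&0&0&0\\ 0&0&-\frac9{17}&\frac{32}{17}&-\frac{13}{17}&-\frac{1166}{17}&\frac{1024}{17}&\frac{216}{17}&-\frac{108}{17}&\frac{24}{17}&0&0&0&0\\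 0&0&\frac83&-12&24&\frac{976}3&-368&36&-18&80&-59&-18&9&-2\\ 0&0&-\frac{34}{81}&\frac{17}9&-\frac{34}9&-\frac{3203}{81}&\frac{1576}{27}&-32&20&-\frac{622}{27}&\frac{412}{27}&\frac{16}3&-\frac83&\frac{16}{27}\\ 0&0&\frac{16}{81}&-\frac89&\frac{16}9&\frac{1412}{81}&-\frac{622}{27}&20&-32&\frac{1576}{27}&-\frac{943}{27}&-\frac{34}3&\frac{17}3&-\frac{34}{27}\\ 0&0&-\frac23&3&-6&-\frac{199}3&80&-18&36&-368&296&72&-36&8 \end{array}\right].$$ Interface truncation error. At the eight interface nodes, in the order $x_4,x_3,x_2,x_1$, then the four nodes of $I_1$ from left to right, $$\mathbf{T}_\Gamma=h^2\,U_{xxxx}(0,t)\left[-\tfrac{11}{588},-\tfrac5{516},\tfrac1{12},-\tfrac{337}{612},\tfrac{209}{108},-\tfrac{893}{2916},\tfrac{407}{2916},-\tfrac{17}{36}\right]^T.$$ Norm. For a grid vector $\boldsymbol\delta=[\boldsymbol\delta^-;\boldsymbol\delta^+]$ with FD components $\delta^-_j$ and DG components $\boldsymbol\delta^{+(j)}\in\mathbb{R}^4$ on element $I_j$, $$\|\boldsymbol\delta\|_h^2=h\sum_{j=1}^\infty|\delta_j^-|^2+\frac h4\sum_{j=1}^\infty|\boldsymbol\delta^{+(j)}|^2.$$ *)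

theory Defs
  imports "HOL-Analysis.Analysis"
begin

text \<open>
  \<open>FD j\<close> is the finite difference node \<open>-(j - 1)h\<close>; \<open>DG j i\<close> is the \<open>i\<close>-th Lagrange node,
  counted from the left, of the element \<open>((j - 1)h, jh)\<close>. All indices start at 1; the values of
  a grid vector at other indices are irrelevant.
\<close>

datatype node = FD nat | DG nat nat

type_synonym grid_vec = "node \<Rightarrow> real"

definition nodes :: "node set" where
  "nodes = FD ` {1..} \<union> (\<lambda>(j, i). DG j i) ` ({1..} \<times> {1..4})"

definition elem :: "grid_vec \<Rightarrow> nat \<Rightarrow> real list" where
  "elem z j = map (\<lambda>i. z (DG j i)) [1, 2, 3, 4]"

definition mat_vec :: "real list list \<Rightarrow> real list \<Rightarrow> real list" where
  "mat_vec M v = map (\<lambda>r. \<Sum>(a, b)\<leftarrow>zip r v. a * b) M"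

definition DG_matrix :: "real list list" where
  "DG_matrix =
    [[8, -36, 72, 296, -368, 36, -18, 80, -59, -18, 9, -2],
     [-34/27, 17/3, -34/3, -943/27, 1576/27, -32, 20, -622/27, 412/27, 16/3, -8/3, 16/27],
     [16/27, -8/3, 16/3, 412/27, -622/27, 20, -32, 1576/27, -943/27, -34/3, 17/3, -34/27],
     [-2, 9, -18, -59, 80, -18, 36, -368, 296, 72, -36, 8]]"

text \<open>
  Rows: \<open>FD 4\<close>, \<open>FD 3\<close>, \<open>FD 2\<close>, \<open>FD 1\<close>, \<open>DG 1 1\<close>, \<open>DG 1 2\<close>, \<open>DG 1 3\<close>, \<open>DG 1 4\<close>.
  Columns: \<open>FD 6\<close>, ..., \<open>FD 1\<close>, \<open>DG 1 1\<close>, ..., \<open>DG 1 4\<close>, \<open>DG 2 1\<close>, ..., \<open>DG 2 4\<close>.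
\<close>

definition interface_matrix :: "real list list" where
  "interface_matrix =
    [[-4/49, 64/49, -118/49, 59/49, 0, -9/49, 8/49, 0, 0, 0, 0, 0, 0, 0],
     [0, -4/43, 59/43, -110/43, 59/43, 32/43, -36/43, 0, 0, 0, 0, 0, 0, 0],
     [0, 0, 0, 1, -2, -13/59, 72/59, 0, 0, 0, 0, 0, 0, 0],
     [0, 0, -9/17, 32/17, -13/17, -1166/17, 1024/17, 216/17, -108/17, 24/17, 0, 0, 0, 0],
     [0, 0, 8/3, -12, 24, 976/3, -368, 36, -18, 80, -59, -18, 9, -2],
     [0, 0, -34/81, 17/9, -34/9, -3203/81, 1576/27, -32, 20, -622/27, 412/27, 16/3, -8/3, 16/27],
     [0, 0, 16/81, -8/9, 16/9, 1412/81, -622/27, 20, -32, 1576/27, -943/27, -34/3, 17/3, -34/27],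
     [0, 0, -2/3, 3, -6, -199/3, 80, -18, 36, -368, 296, 72, -36, 8]]"

definition interface_apply :: "grid_vec \<Rightarrow> real list" where
  "interface_apply z =
    mat_vec interface_matrix
      (map (\<lambda>j. z (FD j)) [6, 5, 4, 3, 2, 1] @ elem z 1 @ elem z 2)"

fun Q :: "real \<Rightarrow> grid_vec \<Rightarrow> grid_vec" where
  "Q h z (FD j) =
    (if 5 \<le> j
     then 1 / h\<^sup>2 * (- 1/12 * z (FD (j - 2)) + 4/3 * z (FD (j - 1)) - 5/2 * z (FD j)
            + 4/3 * z (FD (j + 1)) - 1/12 * z (FD (j + 2)))
     else 1 / h\<^sup>2 * interface_apply z ! (4 - j))"
| "Q h z (DG j i) =
    (if 2 \<le> j
     then 1 / h\<^sup>2 * mat_vec DG_matrix (elem z (j - 1) @ elem z j @ elem z (j + 1)) ! (i - 1)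
     else 1 / h\<^sup>2 * interface_apply z ! (3 + i))"

definition T_coeffs :: "real list" where
  "T_coeffs = [-11/588, -5/516, 1/12, -337/612, 209/108, -893/2916, 407/2916, -17/36]"

text \<open>The truncation error, where \<open>a\<close> stands for the value \<open>U\<^sub>x\<^sub>x\<^sub>x\<^sub>x(0, t)\<close>.\<close>

fun truncation :: "real \<Rightarrow> real \<Rightarrow> grid_vec" where
  "truncation h a (FD j) = (if j \<le> 4 then h\<^sup>2 * a * T_coeffs ! (4 - j) else 0)"
| "truncation h a (DG j i) = (if j \<le> 1 then h\<^sup>2 * a * T_coeffs ! (3 + i) else 0)"

definition hnorm :: "real \<Rightarrow> grid_vec \<Rightarrow> real" where
  "hnorm h z =
    sqrt (h * (\<Sum>\<^sub>\<infinity>j\<in>{1..}. (z (FD j))\<^sup>2) + h / 4 * (\<Sum>\<^sub>\<infinity>j\<in>{1..}. \<Sum>i=1..4. (z (DG j i))\<^sup>2))"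

definition smooth :: "(real \<Rightarrow> real) \<Rightarrow> bool" where
  "smooth f \<longleftrightarrow> (\<forall>n x. (deriv ^^ n) f differentiable (at x))"

text \<open>
  \<open>D i j\<close> is the partial derivative of order \<open>i\<close> in \<open>x\<close> and order \<open>j\<close> in \<open>t\<close> (one-sided in time
  at \<open>0\<close> and \<open>T\<close>). The solution is a classical one, i.e. it is \<open>C\<^sup>2\<close> up to the boundary of the
  strip; higher regularity is a consequence of the smoothness of the initial data.
\<close>

definition wave_solution :: "real \<Rightarrow> (real \<Rightarrow> real \<Rightarrow> real) \<Rightarrow> bool" where
  "wave_solution T U \<longleftrightarrow>
    (\<exists>D :: nat \<Rightarrow> nat \<Rightarrow> real \<Rightarrow> real \<Rightarrow> real.
      D 0 0 = U \<and>
      (\<forall>i j. i + j < 2 \<longrightarrow> (\<forall>x. \<forall>t\<in>{0..T}.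
        ((\<lambda>y. D i j y t) has_real_derivative D (i + 1) j x t) (at x) \<and>
        ((\<lambda>s. D i j x s) has_real_derivative D i (j + 1) x t) (at t within {0..T}))) \<and>
      (\<forall>i j. i + j \<le> 2 \<longrightarrow> continuous_on (UNIV \<times> {0..T}) (\<lambda>(x, t). D i j x t)) \<and>
      (\<forall>x. \<forall>t\<in>{0<..T}. D 0 2 x t = D 2 0 x t) \<and>
      smooth (\<lambda>x. U x 0) \<and> bounded {x. U x 0 \<noteq> 0} \<and>
      smooth (\<lambda>x. D 0 1 x 0) \<and> bounded {x. D 0 1 x 0 \<noteq> 0})"

definition Uxxxx_interface :: "(real \<Rightarrow> real \<Rightarrow> real) \<Rightarrow> real \<Rightarrow> real" where
  "Uxxxx_interface U t = (deriv ^^ 4) (\<lambda>x. U x t) 0"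

text \<open>
  The infinite system is posed in the space of grid vectors of finite norm: without a growth
  condition at infinity the nodewise equations do not determine the solution. Nodewise
  derivatives together with a bound on the norm on \<open>[0, T]\<close> are implied by differentiability with
  respect to \<open>hnorm h\<close>. The \<open>summable_on\<close> condition is needed because \<open>infsum\<close> is \<open>0\<close> for divergent
  series.
\<close>

definition error_solution ::
  "real \<Rightarrow> real \<Rightarrow> (real \<Rightarrow> real) \<Rightarrow> (real \<Rightarrow> grid_vec) \<Rightarrow> bool" where
  "error_solution h T a \<delta> \<longleftrightarrow>
    (\<exists>B. \<forall>t\<in>{0..T}. (\<lambda>p. (\<delta> t p)\<^sup>2) summable_on nodes \<and> hnorm h (\<delta> t) \<le> B) \<and>
    (\<exists>\<delta>'. \<forall>p\<in>nodes. \<delta> 0 p = 0 \<and> \<delta>' 0 p = 0 \<and>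
      (\<forall>t\<in>{0..T}.
        ((\<lambda>s. \<delta> s p) has_real_derivative \<delta>' t p) (at t within {0..T}) \<and>
        ((\<lambda>s. \<delta>' s p) has_real_derivative Q h (\<delta> t) p + truncation h (a t) p)
          (at t within {0..T})))"

end

theory Submission
  imports Defs
begin

text \<open>
  Three facts make the error two orders smaller in \<open>h\<close> than its forcing.

  Stability. \<open>h\<^sup>2 Q\<close> is symmetric and negative semidefinite for the inner product that weights the
  finite difference nodes with the boundary weights of the SBP operator and the elements with the
  mass matrix of cubic polynomials. Summation by parts (\<open>summation_by_parts\<close>) turns \<open>- h\<^sup>2 Q\<close> into a
  sum of squares of differences on the left, an interior penalty form with penalty parameter 25 on
  the right, and one more penalty face at \<open>x = 0\<close>. The penalty dominates the consistency terms
  (\<open>energy_form_nonneg\<close>), so the second order system has an energy (\<open>energy_estimate\<close>).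

  Structure of the forcing. The energy estimate applied directly to the forcing of size \<open>h\<^sup>2\<close> at eight
  nodes gives only order 5/2. But the weighted sum of the forcing vanishes, so it acts like \<open>h\<^sup>4\<close> times
  the derivative of a point mass, to which the wave equation responds with a jump of size \<open>h\<^sup>4\<close>. In
  discrete terms the forcing lies in the range of \<open>Q\<close>: a grid vector \<open>w\<close> that tends to a constant on
  the left and to 0 on the right, exponentially in the node index, solves \<open>h\<^sup>2 Q w = T\<close>, where \<open>T\<close> is
  the vector of the coefficients of the truncation error (\<open>stationary_corrector\<close>). Cutting the
  constant off at distance 2 from the interface makes the norm finite and leaves a residual whose
  norm is bounded uniformly in \<open>h\<close> (\<open>corrector\<close>).

  Integration in time. With \<open>a = U\<^sub>x\<^sub>x\<^sub>x\<^sub>x(0, \<cdot>)\<close>, \<open>A\<close> its antiderivative, \<open>E\<close> the time integral of the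
  error and \<open>\<phi>\<close> the corrector, \<open>y = E + h\<^sup>4 A \<phi>\<close> solves the scheme with a forcing of size \<open>h\<^sup>4\<close> and starts
  from 0 with velocity \<open>h\<^sup>4 a(0) \<phi>\<close>. The energy estimate bounds \<open>y\<^sub>t\<close>, and the error is
  \<open>y\<^sub>t - h\<^sup>4 a \<phi>\<close> (\<open>error_bound\<close>). Estimating the error without integrating first would need the
  potential energy of \<open>h\<^sup>4 a(0) \<phi>\<close>, which is too large, because \<open>\<phi>\<close> jumps by an amount of order 1
  between neighbouring nodes. The argument uses one derivative of \<open>a\<close>, which exists because
  d'Alembert's formula carries the smoothness of the initial data to the interface
  (\<open>wave_trace_regular\<close>).
\<close>

section \<open>Local functionals on the grid\<close>

text \<open>
  \<open>Q\<close> and every difference operator below read finitely many nodes. This is what allows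
  differentiation in time node by node.
\<close>

definition local_functional :: "(grid_vec \<Rightarrow> real) \<Rightarrow> bool" where
  "local_functional l \<longleftrightarrow>
    (\<exists>S c. finite S \<and> S \<subseteq> nodes \<and> (\<forall>z. l z = (\<Sum>p\<in>S. c p * z p)))"

lemma FD_in_nodes [simp]: "FD j \<in> nodes \<longleftrightarrow> 1 \<le> j"
  by (auto simp: nodes_def)

lemma DG_in_nodes [simp]: "DG j i \<in> nodes \<longleftrightarrow> 1 \<le> j \<and> i \<in> {1..4}"
  by (auto simp: nodes_def)

lemma local_functional_node: "p \<in> nodes \<Longrightarrow> local_functional (\<lambda>z. z p)"
  unfolding local_functional_def
  by (rule exI[of _ "{p}"], rule exI[of _ "\<lambda>_. 1"]) auto

lemma local_functional_scale:
  assumes "local_functional l"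
  shows "local_functional (\<lambda>z. a * l z)"
proof -
  obtain S c where S: "finite S" "S \<subseteq> nodes" and l: "l z = (\<Sum>p\<in>S. c p * z p)" for z
    using assms by (auto simp: local_functional_def)
  have "a * l z = (\<Sum>p\<in>S. (a * c p) * z p)" for z
    by (simp add: l sum_distrib_left mult.assoc)
  then show ?thesis
    unfolding local_functional_def using S by (intro exI[of _ S] exI[of _ "\<lambda>p. a * c p"]) auto
qed

lemma local_functional_add:
  assumes "local_functional l" "local_functional m"
  shows "local_functional (\<lambda>z. l z + m z)"
proof -
  obtain S c where S: "finite S" "S \<subseteq> nodes" and l: "l z = (\<Sum>p\<in>S. c p * z p)" for z
    using assms by (auto simp: local_functional_def)
  obtain R d where R: "finite R" "R \<subseteq> nodes" and m: "m z = (\<Sum>p\<in>R. d p * z p)" for z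
    using assms by (auto simp: local_functional_def)
  define e where "e p = (if p \<in> S then c p else 0) + (if p \<in> R then d p else 0)" for p
  have "l z + m z = (\<Sum>p\<in>S \<union> R. e p * z p)" for z
  proof -
    have "l z = (\<Sum>p\<in>S \<union> R. (if p \<in> S then c p else 0) * z p)"
      unfolding l using S R by (intro sum.mono_neutral_cong_left) auto
    moreover have "m z = (\<Sum>p\<in>S \<union> R. (if p \<in> R then d p else 0) * z p)"
      unfolding m using S R by (intro sum.mono_neutral_cong_left) auto
    ultimately show ?thesis
      by (simp add: e_def distrib_right sum.distrib)
  qed
  then show ?thesis
    unfolding local_functional_def using S R by (intro exI[of _ "S \<union> R"] exI[of _ e]) auto
qed

lemma local_functional_scale_right:
  "local_functional l \<Longrightarrow> local_functional (\<lambda>z. l z * a)"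
  using local_functional_scale[of l a] by (simp add: mult.commute)

lemma local_functional_divide:
  "local_functional l \<Longrightarrow> local_functional (\<lambda>z. l z / a)"
  using local_functional_scale[of l "1 / a"] by simp

lemma local_functional_minus:
  "local_functional l \<Longrightarrow> local_functional (\<lambda>z. - l z)"
  using local_functional_scale[of l "-1"] by simp

lemma local_functional_diff:
  "local_functional l \<Longrightarrow> local_functional m \<Longrightarrow> local_functional (\<lambda>z. l z - m z)"
  using local_functional_add[OF _ local_functional_minus] by fastforce

lemmas local_functional_intros =
  local_functional_node local_functional_scale local_functional_scale_right
  local_functional_divide local_functional_minus local_functional_add local_functional_diff

lemma local_functional_combination:
  assumes "local_functional l"
  shows "l (\<lambda>p. a * z p + b * w p) = a * l z + b * l w"
proof -
  obtain S c where l: "\<And>z. l z = (\<Sum>p\<in>S. c p * z p)"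
    using assms by (auto simp: local_functional_def)
  show ?thesis
    by (simp add: l algebra_simps sum.distrib sum_distrib_left)
qed

lemma local_functional_has_derivative:
  assumes "local_functional l"
    and "\<And>p. p \<in> nodes \<Longrightarrow> ((\<lambda>s. y s p) has_real_derivative v p) (at t within X)"
  shows "((\<lambda>s. l (y s)) has_real_derivative l v) (at t within X)"
proof -
  obtain S c where S: "finite S" "S \<subseteq> nodes" and l: "\<And>z. l z = (\<Sum>p\<in>S. c p * z p)"
    using assms by (auto simp: local_functional_def)
  show ?thesis
    unfolding l using S(2) by (intro DERIV_sum DERIV_cmult assms(2)) auto
qed

text \<open>
  The four cases are those in which \<open>Q\<close> is given by different formulas.
\<close>

lemma nodes_cases:
  assumes "p \<in> nodes"
  obtains (FD) j where "p = FD j" "5 \<le> j"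
  | (FD_interface) j where "p = FD j" "j \<in> {1, 2, 3, 4}"
  | (DG) j i where "p = DG j i" "2 \<le> j" "i \<in> {1, 2, 3, 4}"
  | (DG_interface) i where "p = DG 1 i" "i \<in> {1, 2, 3, 4}"
proof -
  consider j where "p = FD j" "1 \<le> j" | j i where "p = DG j i" "1 \<le> j" "1 \<le> i" "i \<le> 4"
    using assms by (auto simp: nodes_def)
  then show thesis
  proof cases
    case (1 j)
    have "5 \<le> j \<or> j \<in> {1, 2, 3, 4}" using 1 by auto
    then show thesis using 1 that(1,2) by blast
  next
    case (2 j i)
    have "2 \<le> j \<or> j = 1" and "i \<in> {1, 2, 3, 4}" using 2 by auto
    then show thesis using 2 that(3,4) by blast
  qed
qed

lemma Q_scaling: "Q h z p = Q 1 z p / h\<^sup>2"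
  by (cases p) simp_all

lemmas interface_unfold =
  interface_apply_def mat_vec_def interface_matrix_def elem_def

lemma local_functional_Q:
  assumes "p \<in> nodes"
  shows "local_functional (\<lambda>z. Q h z p)"
  using assms
proof (cases rule: nodes_cases)
  case (FD j)
  then show ?thesis
    by (auto intro!: local_functional_intros)
next
  case (FD_interface j)
  then show ?thesis
    by (auto simp: interface_unfold intro!: local_functional_intros)
next
  case (DG j i)
  then show ?thesis
    by (auto simp: mat_vec_def DG_matrix_def elem_def intro!: local_functional_intros)
next
  case (DG_interface i)
  then show ?thesis
    by (auto simp: interface_unfold intro!: local_functional_intros)
qed

section \<open>Difference operators and bilinear forms of the scheme\<close>

definition fd_diff :: "grid_vec \<Rightarrow> nat \<Rightarrow> real" where
  "fd_diff z j = z (FD j) - z (FD (j + 1))"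

definition fd_diff2 :: "grid_vec \<Rightarrow> nat \<Rightarrow> real" where
  "fd_diff2 z j = z (FD (j - 1)) - 2 * z (FD j) + z (FD (j + 1))"

text \<open>
  The third order one-sided difference for \<open>h\<close> times the derivative at the interface.
\<close>

definition fd_slope :: "grid_vec \<Rightarrow> real" where
  "fd_slope z = 11/6 * z (FD 1) - 3 * z (FD 2) + 3/2 * z (FD 3) - 1/3 * z (FD 4)"

text \<open>
  The derivatives, in the coordinate that maps the element to the unit interval, of the cubic
  interpolant at the two ends of the element.
\<close>

definition dg_slope_left :: "grid_vec \<Rightarrow> nat \<Rightarrow> real" where
  "dg_slope_left z j = - 11/2 * z (DG j 1) + 9 * z (DG j 2) - 9/2 * z (DG j 3) + z (DG j 4)"

definition dg_slope_right :: "grid_vec \<Rightarrow> nat \<Rightarrow> real" where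
  "dg_slope_right z j = - z (DG j 1) + 9/2 * z (DG j 2) - 9 * z (DG j 3) + 11/2 * z (DG j 4)"

definition dg_rise :: "grid_vec \<Rightarrow> nat \<Rightarrow> real" where
  "dg_rise z j = z (DG j 4) - z (DG j 1)"

text \<open>
  Face \<open>j\<close> separates the elements \<open>j\<close> and \<open>j + 1\<close>; face 0 is the interface, where \<open>FD 1\<close> takes the place
  of the left element.
\<close>

definition jump :: "grid_vec \<Rightarrow> nat \<Rightarrow> real" where
  "jump z j = z (DG (j + 1) 1) - (if j = 0 then z (FD 1) else z (DG j 4))"

definition avg_slope :: "grid_vec \<Rightarrow> nat \<Rightarrow> real" where
  "avg_slope z j =
    ((if j = 0 then fd_slope z else dg_slope_right z j) + dg_slope_left z (j + 1)) / 2"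

text \<open>
  The integral over the unit interval of the product of the cubic interpolants.
\<close>

definition mass :: "grid_vec \<Rightarrow> grid_vec \<Rightarrow> nat \<Rightarrow> real" where
  "mass z w j =
    (z (DG j 1) * (128 * w (DG j 1) + 99 * w (DG j 2) - 36 * w (DG j 3) + 19 * w (DG j 4))
     + z (DG j 2) * (99 * w (DG j 1) + 648 * w (DG j 2) - 81 * w (DG j 3) - 36 * w (DG j 4))
     + z (DG j 3) * (- 36 * w (DG j 1) - 81 * w (DG j 2) + 648 * w (DG j 3) + 99 * w (DG j 4))
     + z (DG j 4) * (19 * w (DG j 1) - 36 * w (DG j 2) + 99 * w (DG j 3) + 128 * w (DG j 4))) / 1680"

text \<open>
  The integral over the unit interval of the product of the derivatives of the cubic interpolants:
  the three terms belong to the Legendre coefficients of degree 0, 1 and 2 of the derivatives.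
\<close>

definition stiffness :: "grid_vec \<Rightarrow> grid_vec \<Rightarrow> nat \<Rightarrow> real" where
  "stiffness z w j =
    dg_rise z j * dg_rise w j
    + (dg_slope_right z j - dg_slope_left z j) * (dg_slope_right w j - dg_slope_left w j) / 12
    + ((dg_slope_right z j + dg_slope_left z j) / 2 - dg_rise z j)
      * ((dg_slope_right w j + dg_slope_left w j) / 2 - dg_rise w j) / 5"

text \<open>
  The symmetric interior penalty terms of a face.
\<close>

definition face_form :: "grid_vec \<Rightarrow> grid_vec \<Rightarrow> nat \<Rightarrow> real" where
  "face_form z w j = jump z j * avg_slope w j + avg_slope z j * jump w j + 25 * jump z j * jump w j"

text \<open>
  The boundary weights of the SBP operator of order (4, 2).
\<close>

definition weight :: "nat \<Rightarrow> real" where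
  "weight j = (if j = 1 then 17/48 else if j = 2 then 59/48 else if j = 3 then 43/48
    else if j = 4 then 49/48 else 1)"

text \<open>
  Truncated after \<open>N\<close> nodes and \<open>N\<close> elements, so that sums over the infinite grid occur only in the
  final passage to the limit.
\<close>

definition inner_upto :: "nat \<Rightarrow> grid_vec \<Rightarrow> grid_vec \<Rightarrow> real" where
  "inner_upto N z w = (\<Sum>j=1..N. weight j * z (FD j) * w (FD j) + mass z w j)"

definition fd_density :: "grid_vec \<Rightarrow> grid_vec \<Rightarrow> nat \<Rightarrow> real" where
  "fd_density z w j = fd_diff z (j - 1) * fd_diff w (j - 1) + fd_diff2 z (j - 1) * fd_diff2 w (j - 1) / 12"

text \<open>
  The sums of products of differences are the SBP form near the boundary, arranged so that they are
  sums of squares for \<open>z = w\<close>.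
\<close>

definition interface_form :: "grid_vec \<Rightarrow> grid_vec \<Rightarrow> real" where
  "interface_form z w =
    (\<Sum>j=1..3. fd_diff z j * fd_diff w j)
    + 5/48 * (fd_diff2 z 2 * fd_diff2 w 2) + 1/48 * (fd_diff2 z 3 * fd_diff2 w 3)
    + 1/48 * ((fd_diff2 z 2 + fd_diff2 z 3) * (fd_diff2 w 2 + fd_diff2 w 3))
    + stiffness z w 1 + face_form z w 0"

definition energy_form :: "nat \<Rightarrow> grid_vec \<Rightarrow> grid_vec \<Rightarrow> real" where
  "energy_form N z w = interface_form z w + (\<Sum>j=5..N. fd_density z w j)
    + (\<Sum>j=2..N. stiffness z w j + face_form z w (j - 1))"

text \<open>
  The terms left over by summation by parts at node \<open>j\<close> and, in the next definition, at the right
  end of element \<open>j\<close>.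
\<close>

definition fd_flux :: "nat \<Rightarrow> grid_vec \<Rightarrow> grid_vec \<Rightarrow> real" where
  "fd_flux j z w = z (FD j) * fd_diff w j
    + (z (FD j) * (fd_diff2 w (j + 1) - fd_diff2 w j) + fd_diff z (j - 1) * fd_diff2 w j) / 12"

definition dg_flux :: "nat \<Rightarrow> grid_vec \<Rightarrow> grid_vec \<Rightarrow> real" where
  "dg_flux j z w = - z (DG j 4) * avg_slope w j + dg_slope_right z j * jump w j / 2
    - 25 * z (DG j 4) * jump w j"

lemmas slope_defs = fd_diff_def fd_diff2_def fd_slope_def dg_slope_left_def dg_slope_right_def
  dg_rise_def jump_def avg_slope_def

section \<open>Summation by parts\<close>

text \<open>
  The stencil is the second difference minus a twelfth of the fourth difference; each of the two is
  summed by parts separately.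
\<close>

lemma fd_summation_by_parts:
  assumes "5 \<le> j"
  shows "z (FD j) * Q 1 w (FD j) = - fd_density z w j - fd_flux j z w + fd_flux (j - 1) z w"
proof -
  have n: "j - 1 + 1 = j" "j - 1 - 1 = j - 2" "j - 2 + 1 = j - 1" "j + 1 - 1 = j" "j + 1 + 1 = j + 2"
    using assms by auto
  have Q: "Q 1 w (FD j) = fd_diff w (j - 1) - fd_diff w j
      - (fd_diff2 w (j + 1) - 2 * fd_diff2 w j + fd_diff2 w (j - 1)) / 12"
    unfolding fd_diff_def fd_diff2_def n Q.simps if_P[OF assms] by (simp add: field_simps)
  have z: "fd_diff2 z (j - 1) = fd_diff z (j - 2) - fd_diff z (j - 1)"
    "fd_diff z (j - 1) = z (FD (j - 1)) - z (FD j)"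
    unfolding fd_diff_def fd_diff2_def n by simp_all
  show ?thesis
    unfolding Q fd_density_def fd_flux_def n z(1) unfolding z(2) by (simp add: field_simps)
qed

lemma Q_element:
  assumes "2 \<le> j"
  shows "Q 1 w (DG j 1) = 8 * w (DG (j - 1) 1) - 36 * w (DG (j - 1) 2) + 72 * w (DG (j - 1) 3) + 296 * w (DG (j - 1) 4) - 368 * w (DG j 1) + 36 * w (DG j 2) - 18 * w (DG j 3) + 80 * w (DG j 4) - 59 * w (DG (j + 1) 1) - 18 * w (DG (j + 1) 2) + 9 * w (DG (j + 1) 3) - 2 * w (DG (j + 1) 4)"
    and "Q 1 w (DG j 2) = - 34/27 * w (DG (j - 1) 1) + 17/3 * w (DG (j - 1) 2) - 34/3 * w (DG (j - 1) 3) - 943/27 * w (DG (j - 1) 4) + 1576/27 * w (DG j 1) - 32 * w (DG j 2) + 20 * w (DG j 3) - 622/27 * w (DG j 4) + 412/27 * w (DG (j + 1) 1) + 16/3 * w (DG (j + 1) 2) - 8/3 * w (DG (j + 1) 3) + 16/27 * w (DG (j + 1) 4)"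
    and "Q 1 w (DG j 3) = 16/27 * w (DG (j - 1) 1) - 8/3 * w (DG (j - 1) 2) + 16/3 * w (DG (j - 1) 3) + 412/27 * w (DG (j - 1) 4) - 622/27 * w (DG j 1) + 20 * w (DG j 2) - 32 * w (DG j 3) + 1576/27 * w (DG j 4) - 943/27 * w (DG (j + 1) 1) - 34/3 * w (DG (j + 1) 2) + 17/3 * w (DG (j + 1) 3) - 34/27 * w (DG (j + 1) 4)"
    and "Q 1 w (DG j 4) = - 2 * w (DG (j - 1) 1) + 9 * w (DG (j - 1) 2) - 18 * w (DG (j - 1) 3) - 59 * w (DG (j - 1) 4) + 80 * w (DG j 1) - 18 * w (DG j 2) + 36 * w (DG j 3) - 368 * w (DG j 4) + 296 * w (DG (j + 1) 1) + 72 * w (DG (j + 1) 2) - 36 * w (DG (j + 1) 3) + 8 * w (DG (j + 1) 4)"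
  using assms by (simp_all add: mat_vec_def DG_matrix_def elem_def)

text \<open>
  Multiplying with the mass matrix turns the rows of \<open>Q\<close> into the variational form of the
  discontinuous Galerkin method: the right hand sides are the coefficients of the test values in
  the stiffness form and in the two half faces.
\<close>

lemma mass_row_element:
  assumes "2 \<le> j"
  shows "128 * Q 1 w (DG j 1) + 99 * Q 1 w (DG j 2) - 36 * Q 1 w (DG j 3) + 19 * Q 1 w (DG j 4) =
      - 1680 * ((- 1) * dg_rise w j + 3/8 * (dg_slope_right w j - dg_slope_left w j) + (- 9/20) * ((dg_slope_right w j + dg_slope_left w j) / 2 - dg_rise w j) + (- 11/4) * jump w (j - 1) + (- 1/2) * jump w j + avg_slope w (j - 1) + 25 * jump w (j - 1))" (is ?g1)
    and "99 * Q 1 w (DG j 1) + 648 * Q 1 w (DG j 2) - 81 * Q 1 w (DG j 3) - 36 * Q 1 w (DG j 4) =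
      - 1680 * (0 * dg_rise w j + (- 3/8) * (dg_slope_right w j - dg_slope_left w j) + 27/20 * ((dg_slope_right w j + dg_slope_left w j) / 2 - dg_rise w j) + 9/2 * jump w (j - 1) + 9/4 * jump w j)" (is ?g2)
    and "- 36 * Q 1 w (DG j 1) - 81 * Q 1 w (DG j 2) + 648 * Q 1 w (DG j 3) + 99 * Q 1 w (DG j 4) =
      - 1680 * (0 * dg_rise w j + (- 3/8) * (dg_slope_right w j - dg_slope_left w j) + (- 27/20) * ((dg_slope_right w j + dg_slope_left w j) / 2 - dg_rise w j) + (- 9/4) * jump w (j - 1) + (- 9/2) * jump w j)" (is ?g3)
    and "19 * Q 1 w (DG j 1) - 36 * Q 1 w (DG j 2) + 99 * Q 1 w (DG j 3) + 128 * Q 1 w (DG j 4) =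
      - 1680 * (1 * dg_rise w j + 3/8 * (dg_slope_right w j - dg_slope_left w j) + 9/20 * ((dg_slope_right w j + dg_slope_left w j) / 2 - dg_rise w j) + 1/2 * jump w (j - 1) + 11/4 * jump w j - avg_slope w j - 25 * jump w j)" (is ?g4)
proof -
  have n: "j - 1 + 1 = j" "j \<noteq> 0" "j - 1 \<noteq> 0" using assms by auto
  have j: "jump w (j - 1) = w (DG j 1) - w (DG (j - 1) 4)"
    "avg_slope w (j - 1) = (dg_slope_right w (j - 1) + dg_slope_left w j) / 2"
    "jump w j = w (DG (j + 1) 1) - w (DG j 4)"
    "avg_slope w j = (dg_slope_right w j + dg_slope_left w (j + 1)) / 2"
    using assms by (simp_all add: jump_def avg_slope_def)
  note unf = Q_element[OF assms] j dg_slope_left_def dg_slope_right_def dg_rise_def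
  show ?g1 and ?g2 and ?g3 and ?g4
    unfolding unf by (simp_all add: field_simps)
qed

lemma dg_summation_by_parts:
  assumes "2 \<le> j"
  shows "mass z (Q 1 w) j = - (stiffness z w j + face_form z w (j - 1)) - dg_flux j z w + dg_flux (j - 1) z w"
proof -
  have n: "j - 1 + 1 = j" "j \<noteq> 0" "j - 1 \<noteq> 0" using assms by auto
  have z: "jump z (j - 1) = z (DG j 1) - z (DG (j - 1) 4)"
    "avg_slope z (j - 1) = (dg_slope_right z (j - 1) + dg_slope_left z j) / 2"
    using assms by (simp_all add: slope_defs)
  show ?thesis
    unfolding mass_def mass_row_element[OF assms] stiffness_def face_form_def dg_flux_def z
      dg_rise_def[of z j] dg_slope_left_def[of z j] dg_slope_right_def[of z j]
    by (simp add: field_simps)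
qed

lemma Q_interface:
  shows "Q 1 w (FD 4) = - 4/49 * w (FD 6) + 64/49 * w (FD 5) - 118/49 * w (FD 4) + 59/49 * w (FD 3) - 9/49 * w (FD 1) + 8/49 * w (DG 1 1)"
    and "Q 1 w (FD 3) = - 4/43 * w (FD 5) + 59/43 * w (FD 4) - 110/43 * w (FD 3) + 59/43 * w (FD 2) + 32/43 * w (FD 1) - 36/43 * w (DG 1 1)"
    and "Q 1 w (FD 2) = w (FD 3) - 2 * w (FD 2) - 13/59 * w (FD 1) + 72/59 * w (DG 1 1)"
    and "Q 1 w (FD 1) = - 9/17 * w (FD 4) + 32/17 * w (FD 3) - 13/17 * w (FD 2) - 1166/17 * w (FD 1) + 1024/17 * w (DG 1 1) + 216/17 * w (DG 1 2) - 108/17 * w (DG 1 3) + 24/17 * w (DG 1 4)"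
    and "Q 1 w (DG 1 1) = 8/3 * w (FD 4) - 12 * w (FD 3) + 24 * w (FD 2) + 976/3 * w (FD 1) - 368 * w (DG 1 1) + 36 * w (DG 1 2) - 18 * w (DG 1 3) + 80 * w (DG 1 4) - 59 * w (DG 2 1) - 18 * w (DG 2 2) + 9 * w (DG 2 3) - 2 * w (DG 2 4)"
    and "Q 1 w (DG 1 2) = - 34/81 * w (FD 4) + 17/9 * w (FD 3) - 34/9 * w (FD 2) - 3203/81 * w (FD 1) + 1576/27 * w (DG 1 1) - 32 * w (DG 1 2) + 20 * w (DG 1 3) - 622/27 * w (DG 1 4) + 412/27 * w (DG 2 1) + 16/3 * w (DG 2 2) - 8/3 * w (DG 2 3) + 16/27 * w (DG 2 4)"
    and "Q 1 w (DG 1 3) = 16/81 * w (FD 4) - 8/9 * w (FD 3) + 16/9 * w (FD 2) + 1412/81 * w (FD 1) - 622/27 * w (DG 1 1) + 20 * w (DG 1 2) - 32 * w (DG 1 3) + 1576/27 * w (DG 1 4) - 943/27 * w (DG 2 1) - 34/3 * w (DG 2 2) + 17/3 * w (DG 2 3) - 34/27 * w (DG 2 4)"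
    and "Q 1 w (DG 1 4) = - 2/3 * w (FD 4) + 3 * w (FD 3) - 6 * w (FD 2) - 199/3 * w (FD 1) + 80 * w (DG 1 1) - 18 * w (DG 1 2) + 36 * w (DG 1 3) - 368 * w (DG 1 4) + 296 * w (DG 2 1) + 72 * w (DG 2 2) - 36 * w (DG 2 3) + 8 * w (DG 2 4)"
  by (simp_all add: interface_unfold)

lemma interface_slopes:
  "jump w 0 = w (DG 1 1) - w (FD 1)"
  "avg_slope w 0 = (fd_slope w + dg_slope_left w 1) / 2"
  "jump w 1 = w (DG 2 1) - w (DG 1 4)"
  "avg_slope w 1 = (dg_slope_right w 1 + dg_slope_left w 2) / 2"
  by (simp_all add: jump_def avg_slope_def numeral_2_eq_2)

lemma fd_diff_numeral:
  "fd_diff w 1 = w (FD 1) - w (FD 2)"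
  "fd_diff w 2 = w (FD 2) - w (FD 3)"
  "fd_diff w 3 = w (FD 3) - w (FD 4)"
  "fd_diff w 4 = w (FD 4) - w (FD 5)"
  "fd_diff2 w 2 = w (FD 1) - 2 * w (FD 2) + w (FD 3)"
  "fd_diff2 w 3 = w (FD 2) - 2 * w (FD 3) + w (FD 4)"
  "fd_diff2 w 4 = w (FD 3) - 2 * w (FD 4) + w (FD 5)"
  "fd_diff2 w 5 = w (FD 4) - 2 * w (FD 5) + w (FD 6)"
  by (simp_all add: fd_diff_def fd_diff2_def numeral_eq_Suc)

text \<open>
  On the first element the interface enters only through its jump and its average slope, exactly as
  any other face does.
\<close>

lemma mass_row_interface:
  shows "128 * Q 1 w (DG 1 1) + 99 * Q 1 w (DG 1 2) - 36 * Q 1 w (DG 1 3) + 19 * Q 1 w (DG 1 4) =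
      - 1680 * ((- 1) * dg_rise w 1 + 3/8 * (dg_slope_right w 1 - dg_slope_left w 1) + (- 9/20) * ((dg_slope_right w 1 + dg_slope_left w 1) / 2 - dg_rise w 1) + (- 11/4) * jump w 0 + (- 1/2) * jump w 1 + avg_slope w 0 + 25 * jump w 0)" (is ?g1)
    and "99 * Q 1 w (DG 1 1) + 648 * Q 1 w (DG 1 2) - 81 * Q 1 w (DG 1 3) - 36 * Q 1 w (DG 1 4) =
      - 1680 * (0 * dg_rise w 1 + (- 3/8) * (dg_slope_right w 1 - dg_slope_left w 1) + 27/20 * ((dg_slope_right w 1 + dg_slope_left w 1) / 2 - dg_rise w 1) + 9/2 * jump w 0 + 9/4 * jump w 1)" (is ?g2)
    and "- 36 * Q 1 w (DG 1 1) - 81 * Q 1 w (DG 1 2) + 648 * Q 1 w (DG 1 3) + 99 * Q 1 w (DG 1 4) =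
      - 1680 * (0 * dg_rise w 1 + (- 3/8) * (dg_slope_right w 1 - dg_slope_left w 1) + (- 27/20) * ((dg_slope_right w 1 + dg_slope_left w 1) / 2 - dg_rise w 1) + (- 9/4) * jump w 0 + (- 9/2) * jump w 1)" (is ?g3)
    and "19 * Q 1 w (DG 1 1) - 36 * Q 1 w (DG 1 2) + 99 * Q 1 w (DG 1 3) + 128 * Q 1 w (DG 1 4) =
      - 1680 * (1 * dg_rise w 1 + 3/8 * (dg_slope_right w 1 - dg_slope_left w 1) + 9/20 * ((dg_slope_right w 1 + dg_slope_left w 1) / 2 - dg_rise w 1) + 1/2 * jump w 0 + 11/4 * jump w 1 - avg_slope w 1 - 25 * jump w 1)" (is ?g4)
  unfolding Q_interface interface_slopes dg_slope_left_def dg_slope_right_def dg_rise_def fd_slope_def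
  by (simp_all add: field_simps)

text \<open>
  The interface contributes the same jump and the same average slope to the finite difference side,
  with the coefficients of \<open>fd_slope\<close>. This is the reason for the symmetry of the coupling.
\<close>

lemma fd_row_interface:
  shows "17/48 * Q 1 w (FD 1) = - (fd_diff w 1 + 5/48 * fd_diff2 w 2 + 1/48 * (fd_diff2 w 2 + fd_diff2 w 3))
      - 11/12 * jump w 0 + avg_slope w 0 + 25 * jump w 0"
    and "59/48 * Q 1 w (FD 2) = - (fd_diff w 2 - fd_diff w 1 - 5/24 * fd_diff2 w 2 + 1/48 * fd_diff2 w 3
        - 1/48 * (fd_diff2 w 2 + fd_diff2 w 3)) + 3/2 * jump w 0"
    and "43/48 * Q 1 w (FD 3) = - (fd_diff w 3 - fd_diff w 2 + 5/48 * fd_diff2 w 2 - 1/24 * fd_diff2 w 3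
        - 1/48 * (fd_diff2 w 2 + fd_diff2 w 3) + fd_diff2 w 4 / 12) - 3/4 * jump w 0"
    and "49/48 * Q 1 w (FD 4) = - (fd_diff w 4 - fd_diff w 3 + 1/48 * fd_diff2 w 3
        + 1/48 * (fd_diff2 w 2 + fd_diff2 w 3) + fd_diff2 w 5 / 12 - fd_diff2 w 4 / 6) + 1/6 * jump w 0"
  unfolding Q_interface interface_slopes fd_diff_numeral fd_slope_def dg_slope_left_def
  by (simp_all add: field_simps)

lemma interface_summation_by_parts:
  "(\<Sum>j=1..4. weight j * z (FD j) * Q 1 w (FD j)) + mass z (Q 1 w) 1 =
    - interface_form z w - fd_flux 4 z w - dg_flux 1 z w"
proof -
  have sum4: "(\<Sum>j=1..4. f j) = f 1 + f 2 + f 3 + f 4" and sum3: "(\<Sum>j=1..3. f j) = f 1 + f 2 + f 3"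
    for f :: "nat \<Rightarrow> real"
    by (simp_all add: numeral_eq_Suc)
  have n: "(4::nat) + 1 = 5" "(4::nat) - 1 = 3" by simp_all
  have w: "weight 1 * z (FD 1) * Q 1 w (FD 1) = z (FD 1) * (17/48 * Q 1 w (FD 1))"
    "weight 2 * z (FD 2) * Q 1 w (FD 2) = z (FD 2) * (59/48 * Q 1 w (FD 2))"
    "weight 3 * z (FD 3) * Q 1 w (FD 3) = z (FD 3) * (43/48 * Q 1 w (FD 3))"
    "weight 4 * z (FD 4) * Q 1 w (FD 4) = z (FD 4) * (49/48 * Q 1 w (FD 4))"
    by (simp_all add: weight_def)
  show ?thesis
    unfolding sum4 w fd_row_interface mass_def mass_row_interface interface_form_def sum3 stiffness_def face_form_def
      dg_flux_def fd_flux_def n fd_diff_numeral[of z] interface_slopes[of z] fd_slope_def[of z]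
      dg_slope_left_def[of z] dg_slope_right_def[of z 1] dg_rise_def[of z]
    by (simp add: field_simps)
qed

section \<open>Coercivity of the scheme\<close>

definition block_sq :: "grid_vec \<Rightarrow> nat \<Rightarrow> real" where
  "block_sq z j = (z (FD j))\<^sup>2 + (\<Sum>i=1..4. (z (DG j i))\<^sup>2)"

definition sq_upto :: "nat \<Rightarrow> grid_vec \<Rightarrow> real" where
  "sq_upto N z = (\<Sum>j=1..N. block_sq z j)"

definition flux :: "nat \<Rightarrow> grid_vec \<Rightarrow> grid_vec \<Rightarrow> real" where
  "flux N z w = fd_flux N z w + dg_flux N z w"

text \<open>
  The fluxes telescope from node to node and from element to element, starting at the interface.
\<close>

lemma summation_by_parts:
  assumes "4 \<le> N"
  shows "inner_upto N z (Q 1 w) = - energy_form N z w - flux N z w"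
  using assms
proof (induction N rule: dec_induct)
  case base
  have 1: "{1..4} = insert 1 {2..4::nat}" by auto
  have "inner_upto 4 z (Q 1 w) = (\<Sum>j=1..4. weight j * z (FD j) * Q 1 w (FD j)) + mass z (Q 1 w) 1
      + (\<Sum>j=2..4. mass z (Q 1 w) j)"
    unfolding inner_upto_def sum.distrib 1 by simp
  moreover have "(\<Sum>j=2..n. mass z (Q 1 w) j) =
      - (\<Sum>j=2..n. stiffness z w j + face_form z w (j - 1)) - dg_flux n z w + dg_flux 1 z w" if "1 \<le> n" for n
    using that
  proof (induction n rule: dec_induct)
    case base
    then show ?case by simp
  next
    case (step n)
    then show ?case
      by (simp add: dg_summation_by_parts)
  qed
  from this[of 4] have "(\<Sum>j=2..4. mass z (Q 1 w) j) =
      - (\<Sum>j=2..4. stiffness z w j + face_form z w (j - 1)) - dg_flux 4 z w + dg_flux 1 z w" by simp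
  ultimately show ?case
    unfolding interface_summation_by_parts by (simp add: energy_form_def flux_def)
next
  case (step N)
  have "weight (Suc N) = 1" using step.hyps by (simp add: weight_def)
  then have "inner_upto (Suc N) z (Q 1 w) = inner_upto N z (Q 1 w) + z (FD (Suc N)) * Q 1 w (FD (Suc N)) + mass z (Q 1 w) (Suc N)"
    by (simp add: inner_upto_def del: Q.simps)
  also have "z (FD (Suc N)) * Q 1 w (FD (Suc N)) = - fd_density z w (Suc N) - fd_flux (Suc N) z w + fd_flux N z w"
    using fd_summation_by_parts[of "Suc N" z w] step.hyps by simp
  also have "mass z (Q 1 w) (Suc N) = - (stiffness z w (Suc N) + face_form z w N) - dg_flux (Suc N) z w + dg_flux N z w"
    using dg_summation_by_parts[of "Suc N" z w] step.hyps by simp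
  finally show ?case
    using step by (simp add: energy_form_def flux_def)
qed

lemma energy_form_commute: "energy_form N z w = energy_form N w z"
proof -
  have s: "stiffness z w j = stiffness w z j" and f: "face_form z w j = face_form w z j"
    and d: "fd_density z w j = fd_density w z j" for j
    by (simp_all add: stiffness_def face_form_def fd_density_def mult.commute)
  have i: "interface_form z w = interface_form w z"
    unfolding interface_form_def s[of 1] f[of 0] by (simp add: mult.commute)
  show ?thesis
    unfolding energy_form_def i by (simp add: s f d)
qed

lemma mass_commute: "mass z w j = mass w z j"
  by (simp add: mass_def algebra_simps)

lemma inner_upto_commute: "inner_upto N z w = inner_upto N w z"
  unfolding inner_upto_def by (intro sum.cong refl) (simp add: mass_commute mult.commute mult.left_commute)

text \<open>
  The slope at either end of the element pays for the face at that end. The constant 12 is optimal for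
  derivatives of cubic polynomials.
\<close>

lemma stiffness_lower_bound:
  "((dg_slope_left z j)\<^sup>2 + (dg_slope_right z j)\<^sup>2) / 12 \<le> stiffness z z j"
proof -
  define a l r where "a = dg_rise z j" and "l = dg_slope_left z j" and "r = dg_slope_right z j"
  have "stiffness z z j - (l\<^sup>2 + r\<^sup>2) / 12 = 6/5 * (a - (l + r) / 12)\<^sup>2 + (r - l)\<^sup>2 / 24"
    by (simp add: stiffness_def a_def[symmetric] l_def[symmetric] r_def[symmetric]
        power2_eq_square field_simps)
  also have "\<dots> \<ge> 0" by simp
  finally show ?thesis by (simp add: l_def r_def)
qed

text \<open>
  With \<open>J\<close> the jump, the square completed against each end slope costs \<open>3 J\<^sup>2\<close>, well within
  the penalty \<open>25 J\<^sup>2\<close>.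
\<close>

lemma face_form_lower_bound:
  assumes "1 \<le> j"
  shows "- (dg_slope_right z j)\<^sup>2 / 12 - (dg_slope_left z (j + 1))\<^sup>2 / 12 \<le> face_form z z j"
proof -
  define J l r where "J = jump z j" and "l = dg_slope_left z (j + 1)" and "r = dg_slope_right z j"
  have "face_form z z j + r\<^sup>2 / 12 + l\<^sup>2 / 12 = (r + 6 * J)\<^sup>2 / 12 + (l + 6 * J)\<^sup>2 / 12 + 19 * J\<^sup>2"
    using assms
    by (simp add: face_form_def avg_slope_def J_def[symmetric] l_def[symmetric, simplified] r_def[symmetric]
        power2_eq_square field_simps)
  also have "\<dots> \<ge> 0" by simp
  finally show ?thesis by (simp add: l_def r_def)
qed

text \<open>
  On the finite difference side the first three differences play the role of the stiffness form: by
  the Cauchy-Schwarz inequality they dominate \<open>6/29\<close> of the squared one-sided slope.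
\<close>

lemma interface_form_lower_bound: "(dg_slope_right z 1)\<^sup>2 / 12 \<le> interface_form z z"
proof -
  define J l r s where "J = jump z 0" and "l = dg_slope_left z 1" and "r = dg_slope_right z 1"
    and "s = fd_slope z"
  define d1 d2 d3 where "d1 = fd_diff z 1" and "d2 = fd_diff z 2" and "d3 = fd_diff z 3"
  have s: "s = 11/6 * d1 - 7/6 * d2 + 1/3 * d3"
    unfolding s_def d1_def d2_def d3_def fd_diff_numeral fd_slope_def by (simp add: field_simps)
  have "29/6 * (d1\<^sup>2 + d2\<^sup>2 + d3\<^sup>2) - s\<^sup>2 =
      (7/6 * d1 + 11/6 * d2)\<^sup>2 + (1/3 * d1 - 11/6 * d3)\<^sup>2 + (1/3 * d2 + 7/6 * d3)\<^sup>2"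
    unfolding s by (simp add: power2_eq_square field_simps)
  also have "\<dots> \<ge> 0" by simp
  finally have 1: "6/29 * s\<^sup>2 \<le> d1\<^sup>2 + d2\<^sup>2 + d3\<^sup>2" by simp
  have "face_form z z 0 + 6/29 * s\<^sup>2 + l\<^sup>2 / 12 = 6/29 * (s + 29/12 * J)\<^sup>2 + (l + 6 * J)\<^sup>2 / 12 + (25 - 3 - 29/24) * J\<^sup>2"
    by (simp add: face_form_def avg_slope_def J_def[symmetric] l_def[symmetric, simplified] s_def[symmetric]
        power2_eq_square field_simps)
  also have "\<dots> \<ge> 0" by simp
  finally have 2: "- 6/29 * s\<^sup>2 - l\<^sup>2 / 12 \<le> face_form z z 0" by simp
  have "(\<Sum>j=1..3. fd_diff z j * fd_diff z j) = d1\<^sup>2 + d2\<^sup>2 + d3\<^sup>2"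
    by (simp add: d1_def d2_def d3_def numeral_eq_Suc power2_eq_square)
  moreover have "0 \<le> 5/48 * (fd_diff2 z 2 * fd_diff2 z 2) + 1/48 * (fd_diff2 z 3 * fd_diff2 z 3)
    + 1/48 * ((fd_diff2 z 2 + fd_diff2 z 3) * (fd_diff2 z 2 + fd_diff2 z 3))"
    by simp
  ultimately have "face_form z z 0 + stiffness z z 1 + (d1\<^sup>2 + d2\<^sup>2 + d3\<^sup>2) \<le> interface_form z z"
    unfolding interface_form_def by linarith
  then show ?thesis
    using 1 2 stiffness_lower_bound[of z 1] unfolding l_def[symmetric] r_def[symmetric]
    by (simp add: add_divide_distrib)
qed

text \<open>
  Processing the elements from left to right, each face takes what it needs from the element on
  its left and from that on its right; the share of the last right end slope remains.
\<close>

lemma energy_form_nonneg: "0 \<le> energy_form N z z"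
proof -
  have 1: "(dg_slope_right z (max N 1))\<^sup>2 / 12 - (dg_slope_right z 1)\<^sup>2 / 12
      \<le> (\<Sum>j=2..N. stiffness z z j + face_form z z (j - 1))"
  proof (induction N)
    case 0
    then show ?case by simp
  next
    case (Suc N)
    show ?case
    proof (cases "N = 0")
      case False
      have "stiffness z z (Suc N) + face_form z z N \<ge> (dg_slope_right z (Suc N))\<^sup>2 / 12 - (dg_slope_right z N)\<^sup>2 / 12"
        using stiffness_lower_bound[of z "Suc N"] face_form_lower_bound[of N z] False
        by (simp add: add_divide_distrib)
      moreover have "max N 1 = N" "max (Suc N) 1 = Suc N" using False by auto
      ultimately show ?thesis using Suc False by (simp add: sum.nat_ivl_Suc')
    qed simp
  qed
  have 2: "0 \<le> (\<Sum>j=5..N. fd_density z z j)"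
    by (intro sum_nonneg) (simp add: fd_density_def)
  have 3: "0 \<le> (dg_slope_right z (max N 1))\<^sup>2 / 12" by simp
  show ?thesis
    using 1 2 3 interface_form_lower_bound[of z] unfolding energy_form_def by linarith
qed

lemma block_sq_eq: "block_sq z j = (z (FD j))\<^sup>2 + (z (DG j 1))\<^sup>2 + (z (DG j 2))\<^sup>2 + (z (DG j 3))\<^sup>2 + (z (DG j 4))\<^sup>2"
  by (simp add: block_sq_def numeral_eq_Suc)

lemma block_sq_nonneg [simp]: "0 \<le> block_sq z j"
  by (simp add: block_sq_eq)

text \<open>
  The symmetric and antisymmetric parts of the nodal values decouple in the mass matrix, which
  leaves two quadratic forms in two variables, and these are completed to squares.
\<close>

lemma mass_bounds:
  defines "sq \<equiv> \<lambda>z j. (z (DG j 1))\<^sup>2 + (z (DG j 2))\<^sup>2 + (z (DG j 3))\<^sup>2 + (z (DG j 4))\<^sup>2"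
  shows "sq z j / 28 \<le> mass z z j" and "mass z z j \<le> sq z j"
proof -
  define a b c d where "a = z (DG j 1)" "b = z (DG j 2)" "c = z (DG j 3)" "d = z (DG j 4)"
  note abcd = this
  have "mass z z j - sq z j / 28 = (87 * (a + d + 63/87 * (b + c))\<^sup>2 + (507 - 63\<^sup>2 / 87) * (b + c)\<^sup>2
      + 49 * (a - d + 135/49 * (b - c))\<^sup>2 + (669 - 135\<^sup>2 / 49) * (b - c)\<^sup>2) / 3360"
    unfolding mass_def sq_def abcd[symmetric] by (simp add: power2_eq_square field_simps)
  also have "\<dots> \<ge> 0" by (simp add: power2_eq_square)
  finally show "sq z j / 28 \<le> mass z z j" by simp
  have "sq z j - mass z z j = (1533 * (a + d - 63/1533 * (b + c))\<^sup>2 + (1113 - 63\<^sup>2 / 1533) * (b + c)\<^sup>2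
      + 1571 * (a - d - 135/1571 * (b - c))\<^sup>2 + (951 - 135\<^sup>2 / 1571) * (b - c)\<^sup>2) / 3360"
    unfolding mass_def sq_def abcd[symmetric] by (simp add: power2_eq_square field_simps)
  also have "\<dots> \<ge> 0" by (simp add: power2_eq_square)
  finally show "mass z z j \<le> sq z j" by simp
qed

lemma inner_upto_bounds:
  shows "sq_upto N z / 28 \<le> inner_upto N z z" and "inner_upto N z z \<le> 2 * sq_upto N z"
proof -
  have *: "block_sq z j / 28 \<le> weight j * z (FD j) * z (FD j) + mass z z j"
    "weight j * z (FD j) * z (FD j) + mass z z j \<le> 2 * block_sq z j" for j
  proof -
    define a s where "a = (z (FD j))\<^sup>2"
      and "s = (z (DG j 1))\<^sup>2 + (z (DG j 2))\<^sup>2 + (z (DG j 3))\<^sup>2 + (z (DG j 4))\<^sup>2"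
    have eq: "block_sq z j = a + s" "weight j * z (FD j) * z (FD j) = weight j * a"
      by (simp_all add: block_sq_eq a_def s_def power2_eq_square)
    have w: "1/28 \<le> weight j" "weight j \<le> 2" by (simp_all add: weight_def)
    have "0 \<le> a" "0 \<le> s" by (simp_all add: a_def s_def)
    moreover from this have "1/28 * a \<le> weight j * a" "weight j * a \<le> 2 * a"
      using w by (auto intro!: mult_right_mono simp del: times_divide_eq_left)
    moreover have "s / 28 \<le> mass z z j" "mass z z j \<le> s"
      using mass_bounds[of z j] by (simp_all add: s_def)
    ultimately show "block_sq z j / 28 \<le> weight j * z (FD j) * z (FD j) + mass z z j"
      "weight j * z (FD j) * z (FD j) + mass z z j \<le> 2 * block_sq z j"
      unfolding eq by simp_all
  qed
  show "sq_upto N z / 28 \<le> inner_upto N z z" "inner_upto N z z \<le> 2 * sq_upto N z"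
    unfolding sq_upto_def inner_upto_def sum_divide_distrib sum_distrib_left by (intro sum_mono *)+
qed

section \<open>Local bilinear forms and boundary flux\<close>

text \<open>
  The counterpart of \<open>local_functional\<close> for bilinear forms, used to differentiate energies.
\<close>

definition local_form :: "(grid_vec \<Rightarrow> grid_vec \<Rightarrow> real) \<Rightarrow> bool" where
  "local_form b \<longleftrightarrow>
    (\<exists>S c. finite S \<and> S \<subseteq> nodes \<times> nodes \<and> (\<forall>z w. b z w = (\<Sum>x\<in>S. c x * (z (fst x) * w (snd x)))))"

lemma local_form_prod:
  assumes "local_functional l" "local_functional m"
  shows "local_form (\<lambda>z w. l z * m w)"
proof -
  obtain S c where S: "finite S" "S \<subseteq> nodes" and l: "l z = (\<Sum>p\<in>S. c p * z p)" for z
    using assms by (auto simp: local_functional_def)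
  obtain R d where R: "finite R" "R \<subseteq> nodes" and m: "m z = (\<Sum>p\<in>R. d p * z p)" for z
    using assms by (auto simp: local_functional_def)
  have "l z * m w = (\<Sum>x\<in>S \<times> R. (c (fst x) * d (snd x)) * (z (fst x) * w (snd x)))" for z w
    unfolding l m sum_product sum.cartesian_product
    by (intro sum.cong) (auto simp: algebra_simps)
  then show ?thesis
    unfolding local_form_def using S R
    by (intro exI[of _ "S \<times> R"] exI[of _ "\<lambda>x. c (fst x) * d (snd x)"]) auto
qed

lemma local_form_scale:
  assumes "local_form b"
  shows "local_form (\<lambda>z w. a * b z w)"
proof -
  obtain S c where S: "finite S" "S \<subseteq> nodes \<times> nodes"
    and b: "b z w = (\<Sum>x\<in>S. c x * (z (fst x) * w (snd x)))" for z w
    using assms by (auto simp: local_form_def)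
  have "a * b z w = (\<Sum>x\<in>S. (a * c x) * (z (fst x) * w (snd x)))" for z w
    by (simp add: b sum_distrib_left mult.assoc)
  then show ?thesis
    unfolding local_form_def using S by (intro exI[of _ S] exI[of _ "\<lambda>p. a * c p"]) auto
qed

lemma local_form_add:
  assumes "local_form b" "local_form b'"
  shows "local_form (\<lambda>z w. b z w + b' z w)"
proof -
  obtain S c where S: "finite S" "S \<subseteq> nodes \<times> nodes"
    and b: "b z w = (\<Sum>x\<in>S. c x * (z (fst x) * w (snd x)))" for z w
    using assms by (auto simp: local_form_def)
  obtain R d where R: "finite R" "R \<subseteq> nodes \<times> nodes"
    and b': "b' z w = (\<Sum>x\<in>R. d x * (z (fst x) * w (snd x)))" for z w
    using assms by (auto simp: local_form_def)
  define e where "e x = (if x \<in> S then c x else 0) + (if x \<in> R then d x else 0)" for x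
  have "b z w + b' z w = (\<Sum>x\<in>S \<union> R. e x * (z (fst x) * w (snd x)))" for z w
  proof -
    have "b z w = (\<Sum>x\<in>S \<union> R. (if x \<in> S then c x else 0) * (z (fst x) * w (snd x)))"
      unfolding b using S R by (intro sum.mono_neutral_cong_left) auto
    moreover have "b' z w = (\<Sum>x\<in>S \<union> R. (if x \<in> R then d x else 0) * (z (fst x) * w (snd x)))"
      unfolding b' using S R by (intro sum.mono_neutral_cong_left) auto
    ultimately show ?thesis
      by (simp add: e_def distrib_right sum.distrib)
  qed
  then show ?thesis
    unfolding local_form_def using S R by (intro exI[of _ "S \<union> R"] exI[of _ e]) auto
qed

lemma local_form_divide: "local_form b \<Longrightarrow> local_form (\<lambda>z w. b z w / a)"
  using local_form_scale[of b "1 / a"] by simp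

lemma local_form_zero: "local_form (\<lambda>z w. 0)"
  unfolding local_form_def by (intro exI[of _ "{}"]) auto

lemma local_form_sum:
  assumes "finite I" and "\<And>i. i \<in> I \<Longrightarrow> local_form (b i)"
  shows "local_form (\<lambda>z w. \<Sum>i\<in>I. b i z w)"
  using assms by (induction I rule: finite_induct) (auto intro: local_form_zero local_form_add)

lemmas local_form_intros = local_form_scale local_form_divide local_form_add local_form_prod

lemma local_form_has_derivative:
  assumes "local_form b"
    and "\<And>p. p \<in> nodes \<Longrightarrow> ((\<lambda>s. y s p) has_real_derivative v p) (at t within X)"
  shows "((\<lambda>s. b (y s) (y s)) has_real_derivative b v (y t) + b (y t) v) (at t within X)"
proof -
  obtain S c where S: "finite S" "S \<subseteq> nodes \<times> nodes"
    and b: "\<And>z w. b z w = (\<Sum>x\<in>S. c x * (z (fst x) * w (snd x)))"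
    using assms by (auto simp: local_form_def)
  have "((\<lambda>s. b (y s) (y s)) has_real_derivative
      (\<Sum>x\<in>S. c x * (v (fst x) * y t (snd x) + v (snd x) * y t (fst x)))) (at t within X)"
    unfolding b using S(2) by (intro DERIV_sum DERIV_cmult DERIV_mult assms(2)) auto
  then show ?thesis
    by (simp add: b sum.distrib[symmetric] algebra_simps)
qed

lemma local_form_combination:
  assumes "local_form b"
  shows "b u (\<lambda>p. \<alpha> * z p + \<beta> * w p) = \<alpha> * b u z + \<beta> * b u w"
    and "b (\<lambda>p. \<alpha> * z p + \<beta> * w p) u = \<alpha> * b z u + \<beta> * b w u"
proof -
  obtain S c where b: "\<And>z w. b z w = (\<Sum>x\<in>S. c x * (z (fst x) * w (snd x)))"
    using assms by (auto simp: local_form_def)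
  show "b u (\<lambda>p. \<alpha> * z p + \<beta> * w p) = \<alpha> * b u z + \<beta> * b u w"
    "b (\<lambda>p. \<alpha> * z p + \<beta> * w p) u = \<alpha> * b z u + \<beta> * b w u"
    by (simp_all add: b algebra_simps sum.distrib sum_distrib_left)
qed

lemma local_form_eq_0:
  assumes "local_form b" "\<And>p. p \<in> nodes \<Longrightarrow> z p = 0"
  shows "b z z = 0"
proof -
  obtain S c where S: "finite S" "S \<subseteq> nodes \<times> nodes"
    and b: "\<And>z w. b z w = (\<Sum>x\<in>S. c x * (z (fst x) * w (snd x)))"
    using assms by (auto simp: local_form_def)
  have "c x * (z (fst x) * z (snd x)) = 0" if "x \<in> S" for x
    using S(2) that assms(2)[of "fst x"] by auto
  then show ?thesis unfolding b by (rule sum.neutral[OF ballI])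
qed

lemma local_functional_slopes:
  "1 \<le> j \<Longrightarrow> local_functional (\<lambda>z. fd_diff z j)"
  "2 \<le> j \<Longrightarrow> local_functional (\<lambda>z. fd_diff2 z j)"
  "local_functional (\<lambda>z. fd_slope z)"
  "1 \<le> j \<Longrightarrow> local_functional (\<lambda>z. dg_slope_left z j)"
  "1 \<le> j \<Longrightarrow> local_functional (\<lambda>z. dg_slope_right z j)"
  "1 \<le> j \<Longrightarrow> local_functional (\<lambda>z. dg_rise z j)"
  unfolding fd_diff_def fd_diff2_def fd_slope_def dg_slope_left_def dg_slope_right_def dg_rise_def
  by (rule local_functional_intros | simp)+

lemma local_functional_jump: "local_functional (\<lambda>z. jump z j)"
  unfolding jump_def by (cases "j = 0") (auto intro!: local_functional_intros)

lemma local_functional_avg_slope: "local_functional (\<lambda>z. avg_slope z j)"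
  unfolding avg_slope_def
  by (cases "j = 0") (auto intro!: local_functional_intros local_functional_slopes)

lemma local_form_stiffness: "1 \<le> j \<Longrightarrow> local_form (\<lambda>z w. stiffness z w j)"
  unfolding stiffness_def
  by (rule local_form_intros local_functional_intros(2-) local_functional_slopes | assumption)+

lemma local_form_face_form: "local_form (\<lambda>z w. face_form z w j)"
  unfolding face_form_def
  by (rule local_form_intros local_functional_jump local_functional_avg_slope local_functional_scale)+

lemma local_form_mass: "1 \<le> j \<Longrightarrow> local_form (\<lambda>z w. mass z w j)"
  unfolding mass_def
  by (rule local_form_intros local_functional_intros | simp)+

lemma local_form_energy_form: "local_form (energy_form N)"
proof -
  have d: "local_form (\<lambda>z w. fd_density z w j)" if "5 \<le> j" for j
    unfolding fd_density_def using that
    by (intro local_form_add local_form_divide local_form_prod local_functional_slopes) auto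
  have i: "local_form interface_form"
    unfolding interface_form_def
    by (intro local_form_add local_form_scale local_form_prod local_form_sum local_form_stiffness
        local_form_face_form local_functional_slopes local_functional_add) auto
  show ?thesis
    unfolding energy_form_def
    by (intro local_form_add local_form_sum i d local_form_stiffness local_form_face_form) auto
qed

lemma local_form_inner_upto: "local_form (inner_upto N)"
  unfolding inner_upto_def
  by (intro local_form_add local_form_sum local_form_mass local_form_prod local_functional_scale
      local_functional_node) auto

lemma flux_bound:
  assumes "2 \<le> N"
  defines "loc \<equiv> \<lambda>z. block_sq z (N - 1) + block_sq z N + block_sq z (N + 1) + block_sq z (N + 2)"
  shows "\<bar>flux N z w\<bar> \<le> 100 * (loc z + loc w)"
proof -
  have n: "N + 1 - 1 = N" "N + 1 + 1 = N + 2" "N - 1 + 1 = N" using assms by auto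
  have bounds: "\<bar>fd_diff z N\<bar> \<le> 2 * sqrt (loc z)" "\<bar>fd_diff2 z N\<bar> \<le> 4 * sqrt (loc z)"
    "\<bar>fd_diff z (N - 1)\<bar> \<le> 2 * sqrt (loc z)" "\<bar>fd_diff2 z (N + 1)\<bar> \<le> 4 * sqrt (loc z)"
    "\<bar>z (FD N)\<bar> \<le> sqrt (loc z)" "\<bar>z (DG N 4)\<bar> \<le> sqrt (loc z)"
    "\<bar>dg_slope_right z N\<bar> \<le> 20 * sqrt (loc z)" "\<bar>avg_slope z N\<bar> \<le> 20 * sqrt (loc z)"
    "\<bar>jump z N\<bar> \<le> 2 * sqrt (loc z)" for z
  proof -
    have sq: "(z (FD j))\<^sup>2 \<le> loc z" if "j \<in> {N - 1, N, N + 1, N + 2}" for j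
      using that unfolding loc_def block_sq_eq by (auto intro!: add_nonneg_nonneg simp: add.assoc)
    have f: "\<bar>z (FD j)\<bar> \<le> sqrt (loc z)" if "j \<in> {N - 1, N, N + 1, N + 2}" for j
      using sq[OF that] by (simp add: real_le_rsqrt)
    have sq: "(z (DG j i))\<^sup>2 \<le> loc z" if "j \<in> {N, N + 1}" "i \<in> {1, 2, 3, 4}" for i j
      using that unfolding loc_def block_sq_eq
      by (elim insertE emptyE; simp add: add.assoc)
    have d: "\<bar>z (DG j i)\<bar> \<le> sqrt (loc z)" if "j \<in> {N, N + 1}" "i \<in> {1, 2, 3, 4}" for i j
      using sq[OF that] by (simp add: real_le_rsqrt)
    have N: "N \<noteq> 0" using assms by simp
    show "\<bar>fd_diff z N\<bar> \<le> 2 * sqrt (loc z)" "\<bar>fd_diff2 z N\<bar> \<le> 4 * sqrt (loc z)"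
      "\<bar>fd_diff z (N - 1)\<bar> \<le> 2 * sqrt (loc z)" "\<bar>fd_diff2 z (N + 1)\<bar> \<le> 4 * sqrt (loc z)"
      "\<bar>z (FD N)\<bar> \<le> sqrt (loc z)" "\<bar>z (DG N 4)\<bar> \<le> sqrt (loc z)"
      using f[of "N - 1"] f[of N] f[of "N + 1"] f[of "N + 2"] d[of N 4]
      unfolding fd_diff_def fd_diff2_def n by auto
    show "\<bar>dg_slope_right z N\<bar> \<le> 20 * sqrt (loc z)"
      using d[of N 1] d[of N 2] d[of N 3] d[of N 4] unfolding dg_slope_right_def by auto
    moreover have "\<bar>dg_slope_left z (N + 1)\<bar> \<le> 20 * sqrt (loc z)"
      using d[of "N + 1" 1] d[of "N + 1" 2] d[of "N + 1" 3] d[of "N + 1" 4]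
      unfolding dg_slope_left_def by auto
    ultimately show "\<bar>avg_slope z N\<bar> \<le> 20 * sqrt (loc z)"
      unfolding avg_slope_def if_not_P[OF N] by auto
    show "\<bar>jump z N\<bar> \<le> 2 * sqrt (loc z)"
      using d[of "N + 1" 1] d[of N 4] unfolding jump_def if_not_P[OF N] by auto
  qed
  have loc: "0 \<le> loc z" for z by (simp add: loc_def)
  define m n where "m = sqrt (loc z)" and "n = sqrt (loc w)"
  have mn: "0 \<le> m" "0 \<le> n" by (simp_all add: m_def n_def loc)
  have prod: "\<bar>a * b\<bar> \<le> c * d * (m * n)" if "\<bar>a\<bar> \<le> c * m" "\<bar>b\<bar> \<le> d * n" for a b c d
  proof -
    have "\<bar>a\<bar> * \<bar>b\<bar> \<le> (c * m) * (d * n)"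
      using that by (intro mult_mono) (auto intro: order_trans[OF abs_ge_zero])
    then show ?thesis by (simp add: abs_mult algebra_simps)
  qed
  note bz = bounds[of z, folded m_def] and bw = bounds[of w, folded n_def]
  have s: "\<bar>fd_diff2 w (N + 1) - fd_diff2 w N\<bar> \<le> 8 * n"
    using bw(2,4) by linarith
  have o: "\<bar>z (FD N)\<bar> \<le> 1 * m" "\<bar>z (DG N 4)\<bar> \<le> 1 * m"
    using bz(5,6) by simp_all
  note products = prod[OF o(1) bw(1)] prod[OF o(1) s] prod[OF bz(3) bw(2)]
    prod[OF o(2) bw(8)] prod[OF bz(7) bw(9)] prod[OF o(2) bw(9)]
  define p1 p2 p3 p4 p5 p6 where "p1 = z (FD N) * fd_diff w N"
    and "p2 = z (FD N) * (fd_diff2 w (N + 1) - fd_diff2 w N)" and "p3 = fd_diff z (N - 1) * fd_diff2 w N"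
    and "p4 = z (DG N 4) * avg_slope w N" and "p5 = dg_slope_right z N * jump w N"
    and "p6 = z (DG N 4) * jump w N"
  note p_defs = this
  have "flux N z w = p1 + p2 / 12 + p3 / 12 + (- p4 + p5 / 2 - 25 * p6)"
    unfolding flux_def fd_flux_def dg_flux_def p_defs by (simp add: add_divide_distrib)
  moreover have "0 \<le> m * n" using mn by simp
  moreover note products[folded p_defs, simplified]
  ultimately have flux: "\<bar>flux N z w\<bar> \<le> 100 * (m * n)"
    unfolding abs_le_iff by linarith
  have "m * n \<le> loc z + loc w"
  proof -
    have "0 \<le> (m - n)\<^sup>2" by simp
    then have "2 * (m * n) \<le> m\<^sup>2 + n\<^sup>2" by (simp add: power2_diff)
    moreover have "m\<^sup>2 = loc z" "n\<^sup>2 = loc w" by (simp_all add: m_def n_def loc)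
    ultimately show ?thesis using loc[of z] loc[of w] by linarith
  qed
  then have *: "100 * (m * n) \<le> 100 * (loc z + loc w)" by (rule mult_left_mono) simp
  show ?thesis by (rule order_trans[OF flux *])
qed

section \<open>Energy estimate\<close>

lemma bound_from_derivative:
  fixes g :: "real \<Rightarrow> real"
  assumes "\<And>s. s \<in> {0..T} \<Longrightarrow> (g has_real_derivative g' s) (at s within {0..T})"
    and "\<And>s. s \<in> {0..T} \<Longrightarrow> g' s \<le> c" and "t \<in> {0..T}"
  shows "g t \<le> g 0 + c * t"
proof -
  have "continuous_on {0..T} g"
    using assms(1) DERIV_continuous_on by blast
  then have "continuous_on {0..t} g"
    by (rule continuous_on_subset) (use assms(3) in auto)
  then have "continuous_on {0..t} (\<lambda>s. g s - c * s)"
    by (intro continuous_intros)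
  moreover have "\<exists>y. ((\<lambda>s. g s - c * s) has_real_derivative y) (at s) \<and> y \<le> 0" if "0 < s" "s < t" for s
  proof -
    have "at s within {0..T} = at s"
      using that assms(3) by (intro at_within_Icc_at) auto
    then have "(g has_real_derivative g' s) (at s)"
      using assms(1)[of s] that assms(3) by auto
    then have "((\<lambda>s. g s - c * s) has_real_derivative g' s - c) (at s)"
      by (auto intro!: derivative_eq_intros)
    moreover have "g' s - c \<le> 0" using assms(2)[of s] that assms(3) by auto
    ultimately show ?thesis by blast
  qed
  ultimately have "g t - c * t \<le> g 0 - c * 0"
    using assms(3) by (intro DERIV_nonpos_imp_decreasing_open[of 0 t "\<lambda>s. g s - c * s"]) auto
  then show ?thesis by simp
qed

lemma sum_block_sq_le_sq_upto: "1 \<le> m \<Longrightarrow> (\<Sum>n<K. block_sq z (m + n)) \<le> sq_upto (m + K) z"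
proof -
  assume m: "1 \<le> m"
  have "(\<Sum>n<K. block_sq z (m + n)) = sum (block_sq z) ((+) m ` {..<K})"
    by (subst sum.reindex) auto
  also have "\<dots> \<le> sum (block_sq z) {1..m + K}"
    using m by (intro sum_mono2) auto
  finally show ?thesis by (simp add: sq_upto_def)
qed

text \<open>
  A crude bound whose only use is to make the boundary fluxes of \<open>y\<close> negligible; it follows by
  differentiating \<open>exp (- s) * sq_upto N (y s)\<close>.
\<close>

lemma sq_upto_integrated:
  assumes "\<And>t p. t \<in> {0..T} \<Longrightarrow> p \<in> nodes \<Longrightarrow>
      ((\<lambda>s. y s p) has_real_derivative v t p) (at t within {0..T})"
    and "\<And>p. p \<in> nodes \<Longrightarrow> y 0 p = 0"
    and "\<And>t. t \<in> {0..T} \<Longrightarrow> sq_upto N (v t) \<le> B"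
    and t: "t \<in> {0..T}"
  shows "sq_upto N (y t) \<le> exp T * B * T"
proof -
  define dot where "dot z w = (\<Sum>j=1..N. z (FD j) * w (FD j) + (\<Sum>i=1..4. z (DG j i) * w (DG j i)))" for z w :: grid_vec
  have dot: "local_form dot"
    unfolding dot_def
    by (intro local_form_sum local_form_add local_form_prod local_functional_node) auto
  have sq: "sq_upto N z = dot z z" for z
    by (simp add: dot_def sq_upto_def block_sq_def power2_eq_square)
  have young: "dot v y + dot y v \<le> dot y y + dot v v" for v y
  proof -
    have "0 \<le> dot (\<lambda>p. 1 * y p + (- 1) * v p) (\<lambda>p. 1 * y p + (- 1) * v p)"
      by (simp add: sq[symmetric] sq_upto_def block_sq_def sum_nonneg)
    then show ?thesis
      unfolding local_form_combination[OF dot] by simp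
  qed
  define g where "g s = exp (- s) * dot (y s) (y s)" for s
  define g' where "g' s = exp (- s) * (dot (v s) (y s) + dot (y s) (v s)) - exp (- s) * dot (y s) (y s)" for s
  have "g t \<le> g 0 + B * t"
  proof (rule bound_from_derivative[OF _ _ t])
    fix s assume s: "s \<in> {0..T}"
    show "(g has_real_derivative g' s) (at s within {0..T})"
      unfolding g_def g'_def
      by (rule derivative_eq_intros local_form_has_derivative[OF dot assms(1)[OF s]] refl | assumption)+
         (simp add: algebra_simps)
    have "g' s \<le> exp (- s) * dot (v s) (v s)"
      unfolding g'_def right_diff_distrib[symmetric] using young[of "v s" "y s"]
      by (intro mult_left_mono) auto
    also have "\<dots> \<le> 1 * dot (v s) (v s)"
      using s by (intro mult_right_mono) (auto simp: sq[symmetric] sq_upto_def sum_nonneg)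
    finally show "g' s \<le> B" using assms(3)[OF s] by (simp add: sq)
  qed
  moreover have "g 0 = 0"
    unfolding g_def using local_form_eq_0[OF dot assms(2)] by simp
  ultimately have "exp t * g t \<le> exp t * (B * t)" by simp
  moreover have "exp t * g t = dot (y t) (y t)"
    by (simp add: g_def exp_minus)
  moreover have "exp t * (B * t) \<le> exp T * (B * T)"
  proof -
    have "0 \<le> B" using assms(3)[OF t] by (rule order_trans[rotated]) (simp add: sq_upto_def sum_nonneg)
    then show ?thesis using t by (intro mult_mono) auto
  qed
  ultimately show ?thesis by (simp add: sq mult.assoc)
qed

lemma inner_upto_mono: "N \<le> N' \<Longrightarrow> inner_upto N z z \<le> inner_upto N' z z"
  unfolding inner_upto_def
proof (rule sum_mono2)
  fix j
  have "0 \<le> mass z z j" by (rule order_trans[OF _ mass_bounds(1)]) simp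
  moreover have "0 \<le> weight j * z (FD j) * z (FD j)"
    by (simp add: weight_def)
  ultimately show "0 \<le> weight j * z (FD j) * z (FD j) + mass z z j" by simp
qed auto

lemma young_inner_upto:
  assumes "0 < c"
  shows "2 * inner_upto N z w \<le> c * inner_upto N z z + inner_upto N w w / c"
proof -
  define s where "s = sqrt c"
  have s: "0 < s" "s * s = c" using assms by (simp_all add: s_def)
  have "0 \<le> inner_upto N (\<lambda>p. s * z p + (- 1 / s) * w p) (\<lambda>p. s * z p + (- 1 / s) * w p)"
    by (rule order_trans[OF _ inner_upto_bounds(1)]) (simp add: sq_upto_def sum_nonneg)
  also have "\<dots> = (s * s) * inner_upto N z z - 2 * (s * (1 / s)) * inner_upto N z w + inner_upto N w w / (s * s)"
    unfolding local_form_combination[OF local_form_inner_upto] by (simp add: inner_upto_commute[of N w z] field_simps)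
  finally show ?thesis using s by simp
qed

text \<open>
  The energy truncated at \<open>N\<close> changes through the forcing and through the flux at \<open>N\<close>. A single flux
  need not be small, but the fluxes have a sum over \<open>N\<close> that is bounded by the norms of \<open>v\<close> and \<open>y\<close>, so
  that the average of the truncated energies over \<open>K\<close> consecutive values of \<open>N\<close> feels a flux of order
  \<open>1 / K\<close> only. The bound depends on \<open>V\<close> and \<open>f\<close> but not on \<open>B\<close>, of which only finiteness matters, nor
  on \<open>h\<close>.
\<close>

lemma energy_estimate:
  assumes h: "0 < h" and T: "0 < T"
    and y': "\<And>t p. t \<in> {0..T} \<Longrightarrow> p \<in> nodes \<Longrightarrow>
      ((\<lambda>s. y s p) has_real_derivative v t p) (at t within {0..T})"
    and v': "\<And>t p. t \<in> {0..T} \<Longrightarrow> p \<in> nodes \<Longrightarrow>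
      ((\<lambda>s. v s p) has_real_derivative Q h (y t) p + F t p) (at t within {0..T})"
    and y0: "\<And>p. p \<in> nodes \<Longrightarrow> y 0 p = 0"
    and vB: "\<And>t N. t \<in> {0..T} \<Longrightarrow> sq_upto N (v t) \<le> B"
    and v0: "\<And>N. sq_upto N (v 0) \<le> V"
    and F: "\<And>t N. t \<in> {0..T} \<Longrightarrow> sq_upto N (F t) \<le> f"
    and t: "t \<in> {0..T}"
  shows "sq_upto N (v t) \<le> 112 * V + 224 * T\<^sup>2 * f"
proof -
  define Y where "Y = exp T * B * T"
  have yB: "sq_upto N (y s) \<le> Y" if "s \<in> {0..T}" for N s
    unfolding Y_def using sq_upto_integrated[OF y' y0 vB that] by blast
  \<comment> \<open>\<open>X\<close> absorbs the work of the forcing without an integral inequality: in the end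
    \<open>X \<le> 2 V + X / 2 + 4 T\<^sup>2 f\<close>, where \<open>X\<close> is finite.\<close>
  define X where "X = Sup {inner_upto N (v s) (v s) | N s. s \<in> {0..T}}"
  have bdd: "bdd_above {inner_upto N (v s) (v s) | N s. s \<in> {0..T}}"
  proof (rule bdd_aboveI[of _ "2 * B"])
    fix x assume "x \<in> {inner_upto N (v s) (v s) | N s. s \<in> {0..T}}"
    then obtain N s where "s \<in> {0..T}" "x = inner_upto N (v s) (v s)" by auto
    then show "x \<le> 2 * B" using inner_upto_bounds(2)[of N "v s"] vB[of s N] by simp
  qed
  have X: "inner_upto N (v s) (v s) \<le> X" if "s \<in> {0..T}" for N s
    unfolding X_def by (rule cSup_upper[OF _ bdd]) (use that in blast)
  define W where "W = 800 * (B + Y) / h\<^sup>2 * T"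
  define e where "e N s = inner_upto N (v s) (v s) + energy_form N (y s) (y s) / h\<^sup>2" for N s
  define e' where "e' N s = 2 * inner_upto N (v s) (F s) - 2 * flux N (v s) (y s) / h\<^sup>2" for N s
  have e': "(e N has_real_derivative e' N s) (at s within {0..T})" if s: "s \<in> {0..T}" and N: "4 \<le> N" for N s
  proof -
    have "(e N has_real_derivative (inner_upto N (\<lambda>p. Q h (y s) p + F s p) (v s) + inner_upto N (v s) (\<lambda>p. Q h (y s) p + F s p))
        + (energy_form N (v s) (y s) + energy_form N (y s) (v s)) / h\<^sup>2) (at s within {0..T})"
      unfolding e_def
      by (intro DERIV_add DERIV_cdivide local_form_has_derivative[OF local_form_inner_upto v'[OF s]]
          local_form_has_derivative[OF local_form_energy_form y'[OF s]])
    moreover have "inner_upto N (v s) (\<lambda>p. Q h (y s) p + F s p) = inner_upto N (v s) (Q 1 (y s)) / h\<^sup>2 + inner_upto N (v s) (F s)"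
    proof -
      have "(\<lambda>p. Q h (y s) p + F s p) = (\<lambda>p. (1 / h\<^sup>2) * Q 1 (y s) p + 1 * F s p)"
        by (rule ext) (simp add: Q_scaling[of h] del: Q.simps)
      then show ?thesis
        by (simp only: local_form_combination[OF local_form_inner_upto]) simp
    qed
    then have "(inner_upto N (\<lambda>p. Q h (y s) p + F s p) (v s) + inner_upto N (v s) (\<lambda>p. Q h (y s) p + F s p))
        + (energy_form N (v s) (y s) + energy_form N (y s) (v s)) / h\<^sup>2 = e' N s"
      unfolding e'_def inner_upto_commute[of N _ "v s"] energy_form_commute[of N _ "v s"] summation_by_parts[OF N]
      by (simp add: diff_divide_distrib)
    ultimately show ?thesis by simp
  qed
  \<comment> \<open>The energies that are averaged start at \<open>N = M + 5\<close>, beyond the interface rows.\<close>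
  have main: "inner_upto M (v t) (v t) \<le> 2 * V + X / 2 + 4 * T\<^sup>2 * f + W / K" if K: "0 < K" and t: "t \<in> {0..T}" for M K :: nat and t
  proof -
    define E where "E s = (\<Sum>n<K. e (M + 5 + n) s)" for s
    define c where "c = real K * (X / (2 * T) + 4 * T * f) + 2 * (400 * (B + Y)) / h\<^sup>2"
    have "E t \<le> E 0 + c * t"
    proof (rule bound_from_derivative[OF _ _ t])
      fix s assume s: "s \<in> {0..T}"
      show "(E has_real_derivative (\<Sum>n<K. e' (M + 5 + n) s)) (at s within {0..T})"
        unfolding E_def by (intro DERIV_sum e'[OF s]) auto
      have "(\<Sum>n<K. 2 * inner_upto (M + 5 + n) (v s) (F s)) \<le> (\<Sum>n<K. X / (2 * T) + 4 * T * f)"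
      proof (rule sum_mono)
        fix n
        have "2 * inner_upto (M + 5 + n) (v s) (F s)
            \<le> 1 / (2 * T) * inner_upto (M + 5 + n) (v s) (v s) + inner_upto (M + 5 + n) (F s) (F s) / (1 / (2 * T))"
          using T by (intro young_inner_upto) simp
        also have "\<dots> \<le> 1 / (2 * T) * X + (2 * f) / (1 / (2 * T))"
          using T X[OF s, of "M + 5 + n"] inner_upto_bounds(2)[of "M + 5 + n" "F s"] F[OF s, of "M + 5 + n"]
          by (intro add_mono mult_left_mono divide_right_mono) auto
        finally show "2 * inner_upto (M + 5 + n) (v s) (F s) \<le> X / (2 * T) + 4 * T * f"
          by (simp add: ac_simps)
      qed
      then have 1: "(\<Sum>n<K. 2 * inner_upto (M + 5 + n) (v s) (F s)) \<le> real K * (X / (2 * T) + 4 * T * f)"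
        by simp
      have loc: "(\<Sum>n<K. block_sq z (M + 4 + n) + block_sq z (M + 5 + n) + block_sq z (M + 6 + n) + block_sq z (M + 7 + n))
          \<le> 4 * C" if "\<And>N. sq_upto N z \<le> C" for z C
      proof -
        have "(\<Sum>n<K. block_sq z (m + n)) \<le> C" if "1 \<le> m" for m
          using sum_block_sq_le_sq_upto[OF that] \<open>\<And>N. sq_upto N z \<le> C\<close> by (rule order_trans)
        from this[of "M + 4"] this[of "M + 5"] this[of "M + 6"] this[of "M + 7"] show ?thesis
          unfolding sum.distrib by linarith
      qed
      have "- (\<Sum>n<K. flux (M + 5 + n) (v s) (y s)) \<le> (\<Sum>n<K. \<bar>flux (M + 5 + n) (v s) (y s)\<bar>)"
        using sum_abs[of "\<lambda>n. flux (M + 5 + n) (v s) (y s)" "{..<K}"] by linarith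
      also have "\<dots> \<le> (\<Sum>n<K. 100 *
          ((block_sq (v s) (M + 4 + n) + block_sq (v s) (M + 5 + n) + block_sq (v s) (M + 6 + n) + block_sq (v s) (M + 7 + n))
          + (block_sq (y s) (M + 4 + n) + block_sq (y s) (M + 5 + n) + block_sq (y s) (M + 6 + n) + block_sq (y s) (M + 7 + n))))"
      proof (rule sum_mono)
        fix n
        have nn: "M + 5 + n - 1 = M + 4 + n" "M + 5 + n + 1 = M + 6 + n" "M + 5 + n + 2 = M + 7 + n" by simp_all
        show "\<bar>flux (M + 5 + n) (v s) (y s)\<bar> \<le> 100 *
          ((block_sq (v s) (M + 4 + n) + block_sq (v s) (M + 5 + n) + block_sq (v s) (M + 6 + n) + block_sq (v s) (M + 7 + n))
          + (block_sq (y s) (M + 4 + n) + block_sq (y s) (M + 5 + n) + block_sq (y s) (M + 6 + n) + block_sq (y s) (M + 7 + n)))"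
          by (rule flux_bound[of "M + 5 + n" "v s" "y s", unfolded nn]) simp
      qed
      also have "\<dots> \<le> 100 * (4 * B + 4 * Y)"
        unfolding sum_distrib_left[symmetric] sum.distrib[of _ _ "{..<K}"]
        using loc[of "v s", OF vB[OF s]] loc[of "y s", OF yB[OF s]] by (simp add: sum.distrib)
      finally have 2: "- (\<Sum>n<K. flux (M + 5 + n) (v s) (y s)) \<le> 400 * (B + Y)" by simp
      have "(\<Sum>n<K. e' (M + 5 + n) s) =
          (\<Sum>n<K. 2 * inner_upto (M + 5 + n) (v s) (F s)) + 2 * (- (\<Sum>n<K. flux (M + 5 + n) (v s) (y s))) / h\<^sup>2"
        by (simp add: e'_def sum_subtractf sum_divide_distrib sum_distrib_left)
      also have "\<dots> \<le> c"
        unfolding c_def using 1 2 by (intro add_mono divide_right_mono mult_left_mono) auto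
      finally show "(\<Sum>n<K. e' (M + 5 + n) s) \<le> c" .
    qed
    moreover have "E 0 \<le> real K * (2 * V)"
    proof -
      have "E 0 = (\<Sum>n<K. inner_upto (M + 5 + n) (v 0) (v 0))"
        using local_form_eq_0[OF local_form_energy_form y0] by (simp add: E_def e_def)
      also have "\<dots> \<le> (\<Sum>n<K. 2 * V)"
        using inner_upto_bounds(2)[of _ "v 0"] v0 by (intro sum_mono) (smt (verit))
      finally show ?thesis by simp
    qed
    moreover have "c * t \<le> c * T"
    proof -
      have "0 \<le> sq_upto 0 (v t)" "0 \<le> sq_upto 0 (y t)" "0 \<le> inner_upto 0 (v t) (v t)" "0 \<le> sq_upto 0 (F t)"
        by (simp_all add: sq_upto_def inner_upto_def)
      then have "0 \<le> B" "0 \<le> Y" "0 \<le> X" "0 \<le> f"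
        using vB[OF t, of 0] yB[OF t, of 0] X[OF t, of 0] F[OF t, of 0] by linarith+
      then have "0 \<le> c" using T unfolding c_def by (intro add_nonneg_nonneg mult_nonneg_nonneg divide_nonneg_nonneg) auto
      then show ?thesis using t by (intro mult_left_mono) auto
    qed
    moreover have "real K * inner_upto M (v t) (v t) \<le> E t"
    proof -
      have "(\<Sum>n<K. inner_upto M (v t) (v t)) \<le> E t"
        unfolding E_def
      proof (rule sum_mono)
        fix n
        have "0 \<le> energy_form (M + 5 + n) (y t) (y t) / h\<^sup>2" using energy_form_nonneg by simp
        then show "inner_upto M (v t) (v t) \<le> e (M + 5 + n) t"
          unfolding e_def using inner_upto_mono[of M "M + 5 + n" "v t"] by simp
      qed
      then show ?thesis by simp
    qed
    ultimately have "real K * inner_upto M (v t) (v t) \<le> real K * (2 * V) + c * T" by linarith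
    also have "\<dots> = real K * (2 * V + X / 2 + 4 * T\<^sup>2 * f + W / K)"
      using K T h by (simp add: c_def W_def field_simps power2_eq_square)
    finally show ?thesis using K by (simp del: of_nat_0_less_iff add: mult_le_cancel_left_pos)
  qed
  have X': "inner_upto M (v s) (v s) \<le> 2 * V + X / 2 + 4 * T\<^sup>2 * f" if s: "s \<in> {0..T}" for M s
  proof (rule field_le_epsilon)
    fix \<epsilon> :: real assume \<epsilon>: "0 < \<epsilon>"
    obtain K :: nat where "W / \<epsilon> < K" using reals_Archimedean2 by blast
    then have "W / \<epsilon> < real (Suc K)" by simp
    then have "W / real (Suc K) < \<epsilon>" using \<epsilon> by (simp add: field_simps del: of_nat_Suc)
    then show "inner_upto M (v s) (v s) \<le> 2 * V + X / 2 + 4 * T\<^sup>2 * f + \<epsilon>"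
      using main[OF zero_less_Suc s, of M K] by linarith
  qed
  have "Sup {inner_upto N (v s) (v s) | N s. s \<in> {0..T}} \<le> 2 * V + X / 2 + 4 * T\<^sup>2 * f"
  proof (rule cSup_least)
    show "{inner_upto N (v s) (v s) | N s. s \<in> {0..T}} \<noteq> {}" using t by blast
  qed (use X' in auto)
  then have "X \<le> 2 * V + X / 2 + 4 * T\<^sup>2 * f" by (simp only: X_def)
  then have "inner_upto N (v t) (v t) \<le> 4 * V + 8 * T\<^sup>2 * f"
    using X[OF t, of N] by linarith
  then show ?thesis using inner_upto_bounds(1)[of N "v t"] by simp
qed

section \<open>Stationary corrector\<close>

text \<open>
  Away from the interface, the solutions of \<open>Q 1 w = 0\<close> that do not grow are spanned by constants and
  by one decaying mode on either side: on the left \<open>\<rho> ^ j\<close> with \<open>\<rho> = 7 - 4 * sqrt 3\<close> a root of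
  \<open>\<rho>\<^sup>4 - 16 \<rho>\<^sup>3 + 30 \<rho>\<^sup>2 - 16 \<rho> + 1\<close>; on the right \<open>\<kappa> ^ j\<close> times a fixed vector \<open>v\<close> of four nodal values,
  with \<open>\<kappa> = (41 - 2 * sqrt 418) / 3\<close> a root of \<open>3 \<kappa>\<^sup>2 - 82 \<kappa> + 3\<close>. What remains is a linear system for the
  values next to the interface and the amplitudes of the modes. Given the jump \<open>J\<close> of \<open>w\<close> at the
  interface, the two halves decouple: the left one is affine in \<open>J\<close> with coefficients in the field
  generated by \<open>sqrt 3\<close>, the right one with coefficients in that generated by \<open>sqrt 418\<close>. The
  definition of the average slope then fixes \<open>J\<close>.

  Testing the equation with the linear grid function shows that the limit \<open>c\<close> on the left is the
  weighted first moment of the truncation error. It is \<open>- 1/36\<close>, not 0, which is why the error is of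
  order 4 and not better.
\<close>

lemma stationary_corrector:
  obtains w c K where "\<And>p. p \<in> nodes \<Longrightarrow> Q 1 w p = truncation 1 1 p"
    and "\<And>N. sq_upto N (\<lambda>p. w p - (case p of FD j \<Rightarrow> c | DG j i \<Rightarrow> 0)) \<le> K"
proof -
  define r s :: real where "r = sqrt 3" and "s = sqrt 418"
  have rr: "r * r = 3" "r * (r * x) = 3 * x" and ss: "s * s = 418" "s * (s * x) = 418 * x" for x
    by (simp_all add: r_def s_def flip: mult.assoc)
  have r: "17/10 \<le> r" "r \<le> 7/4" and s: "20 \<le> s" "s \<le> 41/2"
    unfolding r_def s_def
    by (rule real_le_rsqrt real_le_lsqrt; simp add: power2_eq_square)+
  define \<rho> \<kappa> where "\<rho> = 7 - 4 * r" and "\<kappa> = (41 - 2 * s) / 3"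
  have \<rho>: "0 \<le> \<rho>" "\<rho> \<le> 1/2" and \<kappa>: "0 \<le> \<kappa>" "\<kappa> \<le> 1/2"
    using r s by (simp_all add: \<rho>_def \<kappa>_def)
  \<comment> \<open>The equation for \<open>J\<close> says that average slope plus \<open>25 J\<close> equals \<open>- 13/108\<close>, the value forced by
    testing the right half with the constant 1.\<close>
  define J where "J = (- 1726129/7626960 + 272/10593 * r - 1/3240 * s) / (2485094/208329 - 289/1177 * r + 1/2 * s)"
  define Jr Js where "Jr = J * r" and "Js = J * s"
  have "2485094/208329 - 289/1177 * r + 1/2 * s \<noteq> 0" using r s by simp
  then have "J * (2485094/208329 - 289/1177 * r + 1/2 * s) = - 1726129/7626960 + 272/10593 * r - 1/3240 * s"
    by (simp add: J_def)
  \<comment> \<open>With \<open>Js\<close> eliminated, all equations are identities that are linear in \<open>r\<close>, \<open>s\<close>, \<open>J\<close> and \<open>Jr\<close>.\<close>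
  then have Js: "Js = - 1726129/3813480 + 544/10593 * r - 1/1620 * s - 4970188/208329 * J + 578/1177 * Jr"
    by (simp add: Jr_def Js_def algebra_simps)
  define \<alpha> where "\<alpha> = - 296/10593 + 64/10593 * r - 629/2354 * J + 68/1177 * Jr"
  define \<beta> where "\<beta> = 41/9720 - 1/4860 * s + 41/6 * J - 1/3 * Js"
  define w2 where "w2 = - 491/7062 + 32/10593 * r + 31467/138886 * J + 34/1177 * Jr"
  define v where "v i = (if i = 1 then 1 else if i = 2 then - 71/81 + 2/81 * s
    else if i = 3 then 413/81 - 20/81 * s else - 41/3 + 2/3 * s)" for i :: nat
  define u where "u i = (if i = 1 then 0 else if i = 2 then 13/262440 + 1/131220 * s
    else if i = 3 then 58/32805 - 1/13122 * s else - 41/9720 + 1/4860 * s) + J / 2 * v i" for i :: nat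
  \<comment> \<open>Rows of the interior type first read \<open>FD 3\<close> on the left, and of the first element they read only
    the value and the slope at its right end. Hence \<open>FD 1\<close>, \<open>FD 2\<close> and the first element may deviate
    from the decaying modes.\<close>
  define w where "w p = (case p of
      FD j \<Rightarrow> (if j = 1 then - J / 2 else if j = 2 then w2 else - 1/36 + \<alpha> * \<rho> ^ (j - 3))
    | DG j i \<Rightarrow> (if j = 1 then u i else \<beta> * \<kappa> ^ (j - 2) * v i))" for p
  have \<rho>_powers: "\<rho>\<^sup>2 = 97 - 56 * r" "\<rho> ^ 3 = 1351 - 780 * r" "\<rho> ^ 4 = 18817 - 10864 * r"
    by (simp_all add: \<rho>_def numeral_eq_Suc algebra_simps rr)
  have node_vals:
    "w (FD 1) = - 1/2 * J"
    "w (FD 2) = - 491/7062 + 32/10593 * r + 31467/138886 * J + 34/1177 * Jr"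
    "w (FD 3) = - 787/14124 + 64/10593 * r - 629/2354 * J + 68/1177 * Jr"
    "w (FD 4) = - 1393/4708 + 544/3531 * r - 6035/2354 * J + 1734/1177 * Jr"
    "w (FD 5) = - 53011/14124 + 22784/10593 * r - 83861/2354 * J + 24208/1177 * Jr"
    "w (FD 6) = - 733267/14124 + 317344/10593 * r - 1168019/2354 * J + 337178/1177 * Jr"
    "w (FD 7) = - 3402673/4708 + 1473344/3531 * r - 16268405/2354 * J + 4696284/1177 * Jr"
    "w (DG 1 1) = 1/2 * J"
    "w (DG 1 2) = 13/262440 + 1/131220 * s - 71/162 * J + 1/81 * Js"
    "w (DG 1 3) = 58/32805 - 1/13122 * s + 413/162 * J - 10/81 * Js"
    "w (DG 1 4) = - 41/9720 + 1/4860 * s - 41/6 * J + 1/3 * Js"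
    "w (DG 2 1) = 41/9720 - 1/4860 * s + 41/6 * J - 1/3 * Js"
    "w (DG 2 2) = - 4583/787320 + 28/98415 * s - 4583/486 * J + 112/243 * Js"
    "w (DG 2 3) = 33653/787320 - 823/393660 * s + 33653/486 * J - 823/243 * Js"
    "w (DG 2 4) = - 3353/29160 + 41/7290 * s - 3353/18 * J + 82/9 * Js"
    "w (DG 3 1) = 3353/29160 - 41/7290 * s + 3353/18 * J - 82/9 * Js"
    "w (DG 3 2) = - 375167/2361960 + 1835/236196 * s - 375167/1458 * J + 9175/729 * Js"
    "w (DG 3 3) = 2755829/2361960 - 16849/295245 * s + 2755829/1458 * J - 67396/729 * Js"
    "w (DG 3 4) = - 274577/87480 + 1343/8748 * s - 274577/54 * J + 6715/27 * Js"
    by (simp_all add: w_def w2_def \<alpha>_def u_def v_def \<beta>_def \<rho>_powers Jr_def Js_def, simp_all add: \<rho>_def \<kappa>_def field_simps rr ss)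
  have interface: "Q 1 w (FD 4) = - 11/588" "Q 1 w (FD 3) = - 5/516" "Q 1 w (FD 2) = 1/12"
    "Q 1 w (FD 1) = - 337/612" "Q 1 w (DG 1 1) = 209/108" "Q 1 w (DG 1 2) = - 893/2916"
    "Q 1 w (DG 1 3) = 407/2916" "Q 1 w (DG 1 4) = - 17/36"
    unfolding Q_interface node_vals Js by (simp_all add: algebra_simps)
  have two: "(2::nat) - 1 = 1" "(2::nat) + 1 = 3" by simp_all
  have element2: "Q 1 w (DG 2 1) = 0" "Q 1 w (DG 2 2) = 0" "Q 1 w (DG 2 3) = 0" "Q 1 w (DG 2 4) = 0"
    unfolding Q_element[OF order_refl] two node_vals by (simp_all add: algebra_simps)
  \<comment> \<open>\<open>v\<close> is a null vector of the matrix polynomial of the interior rows at \<open>\<kappa>\<close>.\<close>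
  have pencil: "(8 * v 1 - 36 * v 2 + 72 * v 3 + 296 * v 4) + \<kappa> * (- 368 * v 1 + 36 * v 2 - 18 * v 3 + 80 * v 4) + \<kappa> * (\<kappa> * (- 59 * v 1 - 18 * v 2 + 9 * v 3 - 2 * v 4)) = 0"
    "(- 34/27 * v 1 + 17/3 * v 2 - 34/3 * v 3 - 943/27 * v 4) + \<kappa> * (1576/27 * v 1 - 32 * v 2 + 20 * v 3 - 622/27 * v 4) + \<kappa> * (\<kappa> * (412/27 * v 1 + 16/3 * v 2 - 8/3 * v 3 + 16/27 * v 4)) = 0"
    "(16/27 * v 1 - 8/3 * v 2 + 16/3 * v 3 + 412/27 * v 4) + \<kappa> * (- 622/27 * v 1 + 20 * v 2 - 32 * v 3 + 1576/27 * v 4) + \<kappa> * (\<kappa> * (- 943/27 * v 1 - 34/3 * v 2 + 17/3 * v 3 - 34/27 * v 4)) = 0"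
    "(- 2 * v 1 + 9 * v 2 - 18 * v 3 - 59 * v 4) + \<kappa> * (80 * v 1 - 18 * v 2 + 36 * v 3 - 368 * v 4) + \<kappa> * (\<kappa> * (296 * v 1 + 72 * v 2 - 36 * v 3 + 8 * v 4)) = 0"
    by (simp_all add: v_def \<kappa>_def field_simps ss)
  have eq: "Q 1 w p = truncation 1 1 p" if "p \<in> nodes" for p
    using that
  proof (cases rule: nodes_cases)
    case (FD j)
    define k where "k = j - 5"
    have j: "j = k + 5" using FD by (simp add: k_def)
    have "\<rho> ^ 4 = 16 * \<rho> ^ 3 - 30 * \<rho>\<^sup>2 + 16 * \<rho> - 1"
      unfolding \<rho>_powers by (simp add: \<rho>_def)
    moreover have "Q 1 w p = - \<alpha> * \<rho> ^ k / 12 * (\<rho> ^ 4 - 16 * \<rho> ^ 3 + 30 * \<rho>\<^sup>2 - 16 * \<rho> + 1)"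
      unfolding FD(1) j by (simp add: w_def power_add numeral_eq_Suc field_simps)
    ultimately show ?thesis using FD by (simp del: Q.simps)
  next
    case (FD_interface j)
    then show ?thesis
      using interface(1-4) by (elim insertE emptyE) (simp_all add: T_coeffs_def del: Q.simps)
  next
    case (DG_interface i)
    then show ?thesis
      using interface(5-8) by (elim insertE emptyE) (simp_all add: T_coeffs_def del: Q.simps)
  next
    case (DG j i)
    show ?thesis
    proof (cases "j = 2")
      case True
      have "Q 1 w (DG 2 i) = 0"
        using DG(3) element2 by auto
      then show ?thesis using DG True by (simp del: Q.simps)
    next
      case False
      define k where "k = j - 3"
      have j: "j = k + 3" using DG False by (simp add: k_def)
      have w: "w (DG (k + 3 - 1) i) = \<beta> * \<kappa> ^ k * v i" "w (DG (k + 3) i) = \<beta> * \<kappa> ^ k * (\<kappa> * v i)"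
        "w (DG (k + 3 + 1) i) = \<beta> * \<kappa> ^ k * (\<kappa> * (\<kappa> * v i))" for i
        by (simp_all add: w_def)
      have "2 \<le> k + 3" by simp
      note rows = Q_element[OF this, of w, unfolded w]
      have "Q 1 w (DG (k + 3) 1) = (\<beta> * \<kappa> ^ k) * ((8 * v 1 - 36 * v 2 + 72 * v 3 + 296 * v 4) + \<kappa> * (- 368 * v 1 + 36 * v 2 - 18 * v 3 + 80 * v 4) + \<kappa> * (\<kappa> * (- 59 * v 1 - 18 * v 2 + 9 * v 3 - 2 * v 4)))"
        "Q 1 w (DG (k + 3) 2) = (\<beta> * \<kappa> ^ k) * ((- 34/27 * v 1 + 17/3 * v 2 - 34/3 * v 3 - 943/27 * v 4) + \<kappa> * (1576/27 * v 1 - 32 * v 2 + 20 * v 3 - 622/27 * v 4) + \<kappa> * (\<kappa> * (412/27 * v 1 + 16/3 * v 2 - 8/3 * v 3 + 16/27 * v 4)))"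
        "Q 1 w (DG (k + 3) 3) = (\<beta> * \<kappa> ^ k) * ((16/27 * v 1 - 8/3 * v 2 + 16/3 * v 3 + 412/27 * v 4) + \<kappa> * (- 622/27 * v 1 + 20 * v 2 - 32 * v 3 + 1576/27 * v 4) + \<kappa> * (\<kappa> * (- 943/27 * v 1 - 34/3 * v 2 + 17/3 * v 3 - 34/27 * v 4)))"
        "Q 1 w (DG (k + 3) 4) = (\<beta> * \<kappa> ^ k) * ((- 2 * v 1 + 9 * v 2 - 18 * v 3 - 59 * v 4) + \<kappa> * (80 * v 1 - 18 * v 2 + 36 * v 3 - 368 * v 4) + \<kappa> * (\<kappa> * (296 * v 1 + 72 * v 2 - 36 * v 3 + 8 * v 4)))"
        unfolding rows by (simp_all add: algebra_simps)
      then have "Q 1 w (DG (k + 3) i) = 0"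
        unfolding pencil using DG(3) by auto
      then show ?thesis using DG j by (simp del: Q.simps)
    qed
  qed
  define \<phi> where "\<phi> p = w p - (case p of FD j \<Rightarrow> - 1/36 | DG j i \<Rightarrow> 0)" for p
  define A where "A = \<alpha>\<^sup>2 + \<beta>\<^sup>2 * ((v 1)\<^sup>2 + (v 2)\<^sup>2 + (v 3)\<^sup>2 + (v 4)\<^sup>2)"
  have decay: "block_sq \<phi> (k + 3) \<le> A * (1/2) ^ k" for k
  proof -
    have half: "(x ^ k)\<^sup>2 \<le> (1/2) ^ k" "(x ^ (k + 1))\<^sup>2 \<le> (1/2) ^ k" if "0 \<le> x" "x \<le> 1/2" for x :: real
    proof -
      have x2: "0 \<le> x * x" "x * x \<le> 1/2" using that mult_mono[of x "1/2" x "1/2"] by auto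
      then have "(x * x) ^ k \<le> (1/2) ^ k" by (intro power_mono)
      then show k: "(x ^ k)\<^sup>2 \<le> (1/2) ^ k" by (simp add: power2_eq_square power_mult_distrib)
      have "(x ^ (k + 1))\<^sup>2 = (x * x) * (x ^ k)\<^sup>2" by (simp add: power2_eq_square)
      also have "\<dots> \<le> 1 * (x ^ k)\<^sup>2" using x2 by (intro mult_right_mono) auto
      finally show "(x ^ (k + 1))\<^sup>2 \<le> (1/2) ^ k" using k by simp
    qed
    have "block_sq \<phi> (k + 3) = \<alpha>\<^sup>2 * (\<rho> ^ k)\<^sup>2
        + \<beta>\<^sup>2 * ((v 1)\<^sup>2 + (v 2)\<^sup>2 + (v 3)\<^sup>2 + (v 4)\<^sup>2) * (\<kappa> ^ (k + 1))\<^sup>2"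
      by (simp add: block_sq_eq \<phi>_def w_def power_mult_distrib distrib_left distrib_right mult_ac)
    also have "\<dots> \<le> \<alpha>\<^sup>2 * (1/2) ^ k + \<beta>\<^sup>2 * ((v 1)\<^sup>2 + (v 2)\<^sup>2 + (v 3)\<^sup>2 + (v 4)\<^sup>2) * (1/2) ^ k"
      using half[OF \<rho>] half[OF \<kappa>] by (intro add_mono mult_left_mono) auto
    also have "\<dots> = A * (1/2) ^ k" by (simp add: A_def distrib_right)
    finally show ?thesis .
  qed
  have bound: "sq_upto (n + 2) \<phi> \<le> sq_upto 2 \<phi> + 2 * A - 2 * A * (1/2) ^ n" for n
  proof (induction n)
    case (Suc n)
    have "sq_upto (Suc n + 2) \<phi> = sq_upto (n + 2) \<phi> + block_sq \<phi> (n + 3)"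
      by (simp add: sq_upto_def numeral_3_eq_3)
    then show ?case using Suc decay[of n] by simp
  qed (simp add: numeral_2_eq_2)
  have "0 \<le> A" by (simp add: A_def)
  have "sq_upto N \<phi> \<le> sq_upto 2 \<phi> + 2 * A" for N
  proof -
    have "sq_upto N \<phi> \<le> sq_upto (N + 2) \<phi>"
      unfolding sq_upto_def by (intro sum_mono2) auto
    also have "\<dots> \<le> sq_upto 2 \<phi> + 2 * A" using bound[of N] \<open>0 \<le> A\<close>
      by (smt (verit) mult_nonneg_nonneg zero_le_power half_gt_zero_iff zero_less_one)
    finally show ?thesis .
  qed
  then show thesis
    using that[of w "- 1/36", OF eq] unfolding \<phi>_def[abs_def] by blast
qed

section \<open>Corrector of finite norm\<close>

lemma sq_upto_add: "sq_upto N (\<lambda>p. z p + w p) \<le> 2 * sq_upto N z + 2 * sq_upto N w"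
proof -
  have sq: "(a + b)\<^sup>2 \<le> 2 * a\<^sup>2 + 2 * b\<^sup>2" for a b :: real
    using sum_squares_bound[of a b] by (simp add: power2_sum)
  have "block_sq (\<lambda>p. z p + w p) j \<le> 2 * block_sq z j + 2 * block_sq w j" for j
  proof -
    have "(\<Sum>i=1..4. (z (DG j i) + w (DG j i))\<^sup>2) \<le> (\<Sum>i=1..4. 2 * (z (DG j i))\<^sup>2 + 2 * (w (DG j i))\<^sup>2)"
      by (intro sum_mono sq)
    then show ?thesis
      using sq[of "z (FD j)" "w (FD j)"] by (simp add: block_sq_def sum.distrib sum_distrib_left)
  qed
  then show ?thesis
    unfolding sq_upto_def sum_distrib_left sum.distrib[symmetric] by (intro sum_mono)
qed

lemma sq_upto_scale: "sq_upto N (\<lambda>p. a * z p) = a\<^sup>2 * sq_upto N z"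
  by (simp add: sq_upto_def block_sq_def power_mult_distrib distrib_left sum_distrib_left)

text \<open>
  There are at most \<open>a\<close> positive integers below \<open>a\<close>.
\<close>

lemma sq_upto_le_of_support:
  assumes "\<And>j. 1 \<le> j \<Longrightarrow> block_sq z j \<le> M" "\<And>j. a \<le> real j \<Longrightarrow> block_sq z j = 0" "0 \<le> M" "0 \<le> a"
  shows "sq_upto N z \<le> M * a"
proof -
  have "sq_upto N z = (\<Sum>j\<in>{j\<in>{1..N}. real j < a}. block_sq z j)"
    unfolding sq_upto_def using assms(2) by (intro sum.mono_neutral_right) (auto simp: not_less)
  also have "\<dots> \<le> (\<Sum>j\<in>{j\<in>{1..N}. real j < a}. M)"
    using assms(1) by (intro sum_mono) auto
  also have "\<dots> = M * card {j\<in>{1..N}. real j < a}" by simp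
  also have "\<dots> \<le> M * a"
  proof (rule mult_left_mono)
    have "card {j\<in>{1..N}. real j < a} \<le> card {1..nat \<lfloor>a\<rfloor>}"
      by (rule card_mono) (auto simp: le_nat_floor)
    then show "real (card {j\<in>{1..N}. real j < a}) \<le> a"
      using assms(4) by (simp add: le_nat_iff) linarith
  qed (rule assms(3))
  finally show ?thesis .
qed

lemma truncation_scaling: "truncation h a p = h\<^sup>2 * a * truncation 1 1 p"
  by (cases p) simp_all

text \<open>
  Second differences of this function with step \<open>h\<close> are of size \<open>h\<^sup>2\<close>, and so are those of the
  combination \<open>smooth_step\<close> of three shifts of it, which increases from 0 to 1 between 0 and 2.
\<close>

definition square_ramp :: "real \<Rightarrow> real" where
  "square_ramp x = (max 0 x)\<^sup>2"

lemma square_ramp_second_difference: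
  assumes "0 \<le> h"
  shows "0 \<le> square_ramp (x - h) - 2 * square_ramp x + square_ramp (x + h)"
    and "square_ramp (x - h) - 2 * square_ramp x + square_ramp (x + h) \<le> 2 * h\<^sup>2"
proof -
  consider "x \<le> - h" | "- h \<le> x" "x \<le> 0" | "0 \<le> x" "x \<le> h" | "h \<le> x" using assms by linarith
  then have "0 \<le> square_ramp (x - h) - 2 * square_ramp x + square_ramp (x + h) \<and>
      square_ramp (x - h) - 2 * square_ramp x + square_ramp (x + h) \<le> 2 * h\<^sup>2"
  proof cases
    case 1
    then have "square_ramp (x - h) = 0" "square_ramp x = 0" "square_ramp (x + h) = 0"
      using assms by (simp_all add: square_ramp_def)
    then show ?thesis by simp
  next
    case 2
    then have "square_ramp (x - h) - 2 * square_ramp x + square_ramp (x + h) = (x + h)\<^sup>2"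
      using assms by (simp add: square_ramp_def max_absorb1 max_absorb2)
    moreover have "(x + h)\<^sup>2 \<le> h\<^sup>2" using 2 by (intro power_mono) auto
    ultimately show ?thesis by (auto intro: order_trans[of _ "h\<^sup>2"])
  next
    case 3
    then have "square_ramp (x - h) - 2 * square_ramp x + square_ramp (x + h) = h\<^sup>2 + x * (h + (h - x))"
      using assms by (simp add: square_ramp_def max_absorb1 max_absorb2 power2_eq_square algebra_simps)
    moreover have "h\<^sup>2 + x * (h + (h - x)) = 2 * h\<^sup>2 - (h - x)\<^sup>2"
      by (simp add: power2_eq_square algebra_simps)
    moreover have "0 \<le> x * (h + (h - x))" using 3 by (intro mult_nonneg_nonneg) auto
    ultimately show ?thesis by (auto intro: order_trans[of _ "h\<^sup>2"])
  next
    case 4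
    then have "square_ramp (x - h) - 2 * square_ramp x + square_ramp (x + h) = 2 * h\<^sup>2"
      using assms by (simp add: square_ramp_def max_absorb2 power2_eq_square algebra_simps)
    then show ?thesis by simp
  qed
  then show "0 \<le> square_ramp (x - h) - 2 * square_ramp x + square_ramp (x + h)"
    "square_ramp (x - h) - 2 * square_ramp x + square_ramp (x + h) \<le> 2 * h\<^sup>2" by auto
qed

definition smooth_step :: "real \<Rightarrow> real" where
  "smooth_step x = (square_ramp x - 2 * square_ramp (x - 1) + square_ramp (x - 2)) / 2"

lemma smooth_step_eq_0: "x \<le> 0 \<Longrightarrow> smooth_step x = 0"
  by (simp add: smooth_step_def square_ramp_def)

lemma smooth_step_eq_1: "2 \<le> x \<Longrightarrow> smooth_step x = 1"
  by (simp add: smooth_step_def square_ramp_def power2_eq_square algebra_simps)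

lemma smooth_step_bounds: "0 \<le> smooth_step x" "smooth_step x \<le> 1"
proof -
  have 1: "0 \<le> smooth_step x" using square_ramp_second_difference(1)[of 1 "x - 1"]
    by (simp add: smooth_step_def)
  have 2: "smooth_step x \<le> 1" using square_ramp_second_difference(2)[of 1 "x - 1"]
    by (simp add: smooth_step_def)
  from 1 2 show "0 \<le> smooth_step x" "smooth_step x \<le> 1" .
qed

lemma smooth_step_second_difference:
  assumes "0 \<le> h"
  shows "\<bar>smooth_step (x - h) - 2 * smooth_step x + smooth_step (x + h)\<bar> \<le> 2 * h\<^sup>2"
proof -
  define d where "d y = square_ramp (y - h) - 2 * square_ramp y + square_ramp (y + h)" for y
  have d: "0 \<le> d y" "d y \<le> 2 * h\<^sup>2" for y
    unfolding d_def using square_ramp_second_difference[OF assms] by auto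
  have "x - h - 1 = x - 1 - h" "x - h - 2 = x - 2 - h" "x + h - 1 = x - 1 + h" "x + h - 2 = x - 2 + h" by simp_all
  then have "smooth_step (x - h) - 2 * smooth_step x + smooth_step (x + h) = d x / 2 - d (x - 1) + d (x - 2) / 2"
    unfolding smooth_step_def d_def by (simp add: field_simps)
  moreover have "\<bar>d x / 2 - d (x - 1) + d (x - 2) / 2\<bar> \<le> 2 * h\<^sup>2"
    using d[of x] d[of "x - 1"] d[of "x - 2"] by (intro abs_leI) linarith+
  ultimately show ?thesis by simp
qed

lemma Q_FD_second_differences:
  assumes "5 \<le> j"
  shows "Q 1 w (FD j) = fd_diff2 w j - (fd_diff2 w (j + 1) - 2 * fd_diff2 w j + fd_diff2 w (j - 1)) / 12"
proof -
  have n: "j - 1 + 1 = j" "j - 1 - 1 = j - 2" "j + 1 - 1 = j" "j + 1 + 1 = j + 2"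
    using assms by auto
  show ?thesis
    unfolding fd_diff2_def n Q.simps if_P[OF assms] by (simp add: field_simps)
qed

lemma Q_zero: "p \<in> nodes \<Longrightarrow> Q h (\<lambda>p. 0) p = 0"
  using local_functional_combination[OF local_functional_Q, of p h 0 "\<lambda>p. 0" 0 "\<lambda>p. 0"] by simp

lemma truncation_square_sum: "\<exists>K. \<forall>N. sq_upto N (truncation 1 1) \<le> K"
proof (intro exI allI)
  fix N
  define M where "M = (\<Sum>j\<in>{1..4}. block_sq (truncation 1 1) j)"
  have "block_sq (truncation 1 1) j = 0" if "5 \<le> real j" for j
    using that by (simp add: block_sq_eq)
  moreover have "block_sq (truncation 1 1) j \<le> M" if "1 \<le> j" for j
  proof (cases "j \<le> 4")
    case True
    then show ?thesis unfolding M_def using that by (intro member_le_sum) auto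
  next
    case False
    then show ?thesis by (simp add: block_sq_eq M_def sum_nonneg)
  qed
  ultimately show "sq_upto N (truncation 1 1) \<le> M * 5"
    by (intro sq_upto_le_of_support) (auto simp: M_def sum_nonneg)
qed

text \<open>
  For \<open>h < 1\<close>, the limit \<open>c\<close> of the stationary corrector is multiplied with a cutoff that equals 1 at the
  first six finite difference nodes, so that the interface rows do not see it, and vanishes beyond
  distance 2. It changes \<open>Q \<phi>\<close> by bounded amounts at \<open>O(1 / h)\<close> nodes. For \<open>h \<ge> 1\<close> the truncation error
  itself is small enough to be the residual.
\<close>

lemma corrector:
  obtains K where "0 \<le> K" "\<And>h. 0 < h \<Longrightarrow> \<exists>\<phi> r.
      (\<forall>p\<in>nodes. Q h \<phi> p = truncation 1 1 p / h\<^sup>2 + r p) \<and>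
      (\<forall>N. sq_upto N \<phi> \<le> K / h) \<and> (\<forall>N. sq_upto N r \<le> K / h)"
proof -
  obtain w c K0 where w: "\<And>p. p \<in> nodes \<Longrightarrow> Q 1 w p = truncation 1 1 p"
    and K0: "\<And>N. sq_upto N (\<lambda>p. w p - (case p of FD j \<Rightarrow> c | DG j i \<Rightarrow> 0)) \<le> K0"
    using stationary_corrector by blast
  obtain K1 where K1: "\<And>N. sq_upto N (truncation 1 1) \<le> K1"
    using truncation_square_sum by blast
  have nonneg: "0 \<le> K0" "0 \<le> K1" using K0[of 0] K1[of 0] by (simp_all add: sq_upto_def)
  define K where "K = 2 * K0 + 16 * c\<^sup>2 + 90 * c\<^sup>2 + K1"
  have K: "2 * K0 + 16 * c\<^sup>2 \<le> K" "90 * c\<^sup>2 \<le> K" "K1 \<le> K" "0 \<le> K" using nonneg by (simp_all add: K_def)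
  have "\<exists>\<phi> r. (\<forall>p\<in>nodes. Q h \<phi> p = truncation 1 1 p / h\<^sup>2 + r p) \<and>
      (\<forall>N. sq_upto N \<phi> \<le> K / h) \<and> (\<forall>N. sq_upto N r \<le> K / h)" if h: "0 < h" for h
  proof (cases "1 \<le> h")
    case True
    show ?thesis
    proof (intro exI conjI ballI allI)
      show "Q h (\<lambda>p. 0) p = truncation 1 1 p / h\<^sup>2 + (- 1 / h\<^sup>2) * truncation 1 1 p" if "p \<in> nodes" for p
        using Q_zero[OF that] by simp
      show "sq_upto N (\<lambda>p. 0) \<le> K / h" for N
        using K h by (simp add: sq_upto_def block_sq_def)
      have "(- 1 / h\<^sup>2)\<^sup>2 \<le> 1 / h"
        using True self_le_power[of h 4] by (simp add: power2_eq_square field_simps numeral_eq_Suc)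
      then have "(- 1 / h\<^sup>2)\<^sup>2 * sq_upto N (truncation 1 1) \<le> 1 / h * K1" for N
        using K1[of N] h by (intro mult_mono) (auto simp: sq_upto_def sum_nonneg)
      also have "1 / h * K1 \<le> K / h" using K h by (simp add: divide_right_mono)
      finally show "sq_upto N (\<lambda>p. (- 1 / h\<^sup>2) * truncation 1 1 p) \<le> K / h" for N
        unfolding sq_upto_scale .
    qed
  next
    case False
    \<comment> \<open>\<open>d\<close> is the cutoff minus the indicator of the finite difference nodes.\<close>
    define d where "d p = (case p of FD j \<Rightarrow> - smooth_step ((real j - 6) * h) | DG j i \<Rightarrow> 0)" for p
    define r where "r p = c * (Q 1 d p / h\<^sup>2)" for p
    have d0: "d (FD j) = 0" if "j \<le> 6" for j
      using that h by (simp add: d_def smooth_step_eq_0 mult_nonpos_nonneg)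
    have dDG: "d (DG j i) = 0" for j i by (simp add: d_def)
    have Qd0: "Q 1 d p = 0" if "p \<in> nodes" "\<And>j. p = FD j \<Longrightarrow> j < 5" for p
      using that(1)
    proof (cases rule: nodes_cases)
      case (FD j)
      then show ?thesis using that(2) by fastforce
    next
      case (FD_interface j)
      then show ?thesis by (elim insertE emptyE; simp only: Q_interface d0 dDG; simp add: d0 dDG)
    next
      case (DG_interface i)
      then show ?thesis by (elim insertE emptyE; simp only: Q_interface d0 dDG; simp add: d0 dDG)
    next
      case (DG j i)
      then show ?thesis by (elim insertE emptyE; simp only: Q_element dDG; simp)
    qed
    have diff2: "fd_diff2 d j = - (smooth_step (((real j - 6) * h) - h) - 2 * smooth_step ((real j - 6) * h) + smooth_step (((real j - 6) * h) + h))"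
      if "1 \<le> j" for j
    proof -
      have "(real (j - 1) - 6) * h = (real j - 6) * h - h" "(real (j + 1) - 6) * h = (real j - 6) * h + h"
        using that by (simp_all add: of_nat_diff algebra_simps)
      then show ?thesis by (simp add: fd_diff2_def d_def)
    qed
    have diff2_bound: "\<bar>fd_diff2 d j\<bar> \<le> 2 * h\<^sup>2" if "1 \<le> j" for j
      unfolding diff2[OF that] abs_minus_cancel by (rule smooth_step_second_difference) (use h in simp)
    have diff2_0: "fd_diff2 d j = 0" if "7 + 2 / h \<le> real j" for j
    proof -
      have "2 \<le> (real j - 7) * h" using that h by (simp add: field_simps)
      moreover have "1 \<le> j" using that h by (smt (verit) divide_nonneg_pos of_nat_1 of_nat_le_iff)
      ultimately show ?thesis
        unfolding diff2[OF \<open>1 \<le> j\<close>] using h by (subst (1 2 3) smooth_step_eq_1) (auto simp: algebra_simps)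
    qed
    have Qd: "\<bar>Q 1 d (FD j)\<bar> \<le> 3 * h\<^sup>2" if "5 \<le> j" for j
    proof -
      define x y z where "x = fd_diff2 d j" "y = fd_diff2 d (j + 1)" "z = fd_diff2 d (j - 1)"
      note xyz = this
      have "\<bar>x\<bar> \<le> 2 * h\<^sup>2" "\<bar>y\<bar> \<le> 2 * h\<^sup>2" "\<bar>z\<bar> \<le> 2 * h\<^sup>2"
        unfolding xyz using that by (auto intro!: diff2_bound)
      moreover have "Q 1 d (FD j) = 7/6 * x - y / 12 - z / 12"
        unfolding Q_FD_second_differences[OF that] xyz by (simp add: field_simps)
      ultimately show ?thesis unfolding abs_le_iff by linarith
    qed
    have Qd_far: "Q 1 d (FD j) = 0" if "8 + 2 / h \<le> real j" for j
    proof -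
      have "0 \<le> 2 / h" using h by simp
      then have "8 \<le> real j" using that by linarith
      then have "5 \<le> j" by simp
      then show ?thesis
        unfolding Q_FD_second_differences[OF \<open>5 \<le> j\<close>] using that diff2_0[of j] diff2_0[of "j + 1"] diff2_0[of "j - 1"]
        by (simp add: of_nat_diff)
    qed
    have sq_r: "block_sq r j = (r (FD j))\<^sup>2" if "1 \<le> j" for j
      using Qd0[of "DG j _"] that by (simp add: block_sq_eq r_def del: Q.simps)
    show ?thesis
    proof (intro exI conjI ballI allI)
      fix p assume p: "p \<in> nodes"
      have "Q h (\<lambda>p. 1 * w p + c * d p) p = 1 * Q h w p + c * Q h d p"
        by (rule local_functional_combination[OF local_functional_Q[OF p]])
      then show "Q h (\<lambda>p. 1 * w p + c * d p) p = truncation 1 1 p / h\<^sup>2 + r p"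
        using w[OF p] by (simp add: Q_scaling[of h] r_def)
    next
      fix N
      define e where "e p = (case p of FD j \<Rightarrow> 1 - smooth_step ((real j - 6) * h) | DG j i \<Rightarrow> 0)" for p
      have eq: "(\<lambda>p. 1 * w p + c * d p) = (\<lambda>p. (w p - (case p of FD j \<Rightarrow> c | DG j i \<Rightarrow> 0)) + c * e p)"
        by (rule ext) (simp add: d_def e_def algebra_simps split: node.splits)
      have "sq_upto N e \<le> 1 * (6 + 2 / h)"
      proof (rule sq_upto_le_of_support)
        show "block_sq e j \<le> 1" for j
          using smooth_step_bounds[of "(real j - 6) * h"] by (simp add: block_sq_eq e_def power_le_one)
        show "block_sq e j = 0" if "6 + 2 / h \<le> real j" for j
        proof -
          have "2 \<le> (real j - 6) * h" using that h by (simp add: field_simps)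
          then show ?thesis by (simp add: block_sq_eq e_def smooth_step_eq_1)
        qed
      qed (use h in auto)
      also have "\<dots> \<le> 8 / h" using False h by (simp add: field_simps)
      finally have "sq_upto N e \<le> 8 / h" .
      then have "2 * (c\<^sup>2 * sq_upto N e) \<le> 2 * (c\<^sup>2 * (8 / h))" by (intro mult_left_mono) auto
      moreover have "2 * K0 \<le> 2 * K0 / h" using False h nonneg
        by (simp add: field_simps mult_left_le)
      ultimately have "sq_upto N (\<lambda>p. 1 * w p + c * d p) \<le> 2 * K0 / h + 2 * (c\<^sup>2 * (8 / h))"
        unfolding eq
        using sq_upto_add[of N "\<lambda>p. w p - (case p of FD j \<Rightarrow> c | DG j i \<Rightarrow> 0)" "\<lambda>p. c * e p"] K0[of N]
        unfolding sq_upto_scale by linarith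
      also have "\<dots> = (2 * K0 + 16 * c\<^sup>2) / h" by (simp add: add_divide_distrib)
      also have "\<dots> \<le> K / h" using K h by (intro divide_right_mono) auto
      finally show "sq_upto N (\<lambda>p. 1 * w p + c * d p) \<le> K / h" .
    next
      fix N
      have "sq_upto N r \<le> (9 * c\<^sup>2) * (8 + 2 / h)"
      proof (rule sq_upto_le_of_support)
        show "block_sq r j \<le> 9 * c\<^sup>2" if "1 \<le> j" for j
        proof -
          have "\<bar>Q 1 d (FD j) / h\<^sup>2\<bar> \<le> 3"
          proof (cases "5 \<le> j")
            case True
            then show ?thesis using Qd[of j] h by (simp add: abs_divide field_simps)
          next
            case False
            then show ?thesis using Qd0[of "FD j"] that by (simp del: Q.simps)
          qed
          then have "(Q 1 d (FD j) / h\<^sup>2)\<^sup>2 \<le> 3\<^sup>2" by (rule power2_le_iff_abs_le[THEN iffD2, rotated]) simp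
          then have "c\<^sup>2 * (Q 1 d (FD j) / h\<^sup>2)\<^sup>2 \<le> c\<^sup>2 * 3\<^sup>2" by (intro mult_left_mono) auto
          then show ?thesis unfolding sq_r[OF that] by (simp add: r_def power_mult_distrib power_divide del: Q.simps)
        qed
        show "block_sq r j = 0" if "8 + 2 / h \<le> real j" for j
        proof -
          have "1 \<le> j" using that h by (smt (verit) divide_nonneg_pos of_nat_1 of_nat_le_iff)
          then show ?thesis using Qd_far[OF that] by (simp add: sq_r r_def del: Q.simps)
        qed
      qed (use h in auto)
      also have "\<dots> \<le> (9 * c\<^sup>2) * (10 / h)" using False h by (intro mult_left_mono) (auto simp: field_simps)
      also have "\<dots> \<le> K / h" using K h by (simp add: divide_right_mono)
      finally show "sq_upto N r \<le> K / h" .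
    qed
  qed
  then show thesis using K that by blast
qed

section \<open>Regularity of the trace of the fourth derivative\<close>

text \<open>
  The chain rule for a function with continuous partial derivatives on a closed strip, one-sided at
  its boundary.
\<close>

lemma derivative_along_line:
  fixes u ux ut :: "real \<Rightarrow> real \<Rightarrow> real"
  assumes ux: "\<And>x t. t \<in> {0..T} \<Longrightarrow> ((\<lambda>y. u y t) has_real_derivative ux x t) (at x)"
    and ut: "\<And>x t. t \<in> {0..T} \<Longrightarrow> ((\<lambda>s. u x s) has_real_derivative ut x t) (at t within {0..T})"
    and cont: "continuous_on (UNIV \<times> {0..T}) (\<lambda>(x, t). ux x t)"
    and t: "t \<in> {0..T}"
  shows "((\<lambda>s. u (\<xi> + c * s) s) has_real_derivative c * ux (\<xi> + c * t) t + ut (\<xi> + c * t) t)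
    (at t within {0..T})"
proof -
  have "continuous_on ({0..T} \<times> UNIV) (\<lambda>p. blinfun_mult_right (ux (snd p) (fst p)))"
  proof (intro bounded_linear.continuous_on[OF bounded_linear_blinfun_mult_right])
    have "continuous_on ({0..T} \<times> UNIV) (\<lambda>p. (snd p, fst p) :: real \<times> real)"
      by (intro continuous_intros)
    from continuous_on_compose2[OF cont this]
    show "continuous_on ({0..T} \<times> UNIV) (\<lambda>p. ux (snd p) (fst p))"
      by (simp add: image_subset_iff)
  qed
  then have "continuous (at (t, \<xi> + c * t) within {0..T} \<times> UNIV) (\<lambda>(s, x). blinfun_mult_right (ux x s))"
    using t unfolding continuous_on_eq_continuous_within by (auto simp: case_prod_beta')
  then have "((\<lambda>(s, x). u x s) has_derivative
      (\<lambda>(ds, dx). ut (\<xi> + c * t) t * ds + blinfun_mult_right (ux (\<xi> + c * t) t) dx))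
      (at (t, \<xi> + c * t) within {0..T} \<times> UNIV)"
    using ut[OF t] ux t
    by (intro has_derivative_partialsI) (auto simp: has_field_derivative_def)
  then have total: "((\<lambda>(s, x). u x s) has_derivative
      (\<lambda>(ds, dx). ut (\<xi> + c * t) t * ds + blinfun_mult_right (ux (\<xi> + c * t) t) dx))
      (at (t, \<xi> + c * t) within (\<lambda>s. (s, \<xi> + c * s)) ` {0..T})"
    by (rule has_derivative_subset) auto
  have line: "((\<lambda>s. (s, \<xi> + c * s)) has_derivative (\<lambda>ds. (ds, c * ds))) (at t within {0..T})"
    by (auto intro!: derivative_eq_intros)
  have "((\<lambda>s. u (\<xi> + c * s) s) has_derivative
      (\<lambda>ds. ut (\<xi> + c * t) t * ds + ux (\<xi> + c * t) t * (c * ds))) (at t within {0..T})"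
    using has_derivative_in_compose[OF line total] by simp
  then show ?thesis
    unfolding has_field_derivative_def
    by (rule has_derivative_eq_rhs) (simp add: fun_eq_iff algebra_simps)
qed

lemma smooth_has_derivative:
  assumes "smooth f"
  shows "((deriv ^^ n) f has_real_derivative (deriv ^^ Suc n) f x) (at x)"
  using assms by (simp add: smooth_def DERIV_deriv_iff_real_differentiable)

lemma continuous_on_Icc_abs_bounded:
  fixes k :: "real \<Rightarrow> real"
  assumes "continuous_on {a..b} k"
  shows "\<exists>L. \<forall>t\<in>{a..b}. \<bar>k t\<bar> \<le> L"
proof -
  have "bounded (k ` {a..b})"
    using assms by (intro compact_imp_bounded compact_continuous_image) auto
  then show ?thesis by (auto simp: bounded_iff)
qed

text \<open>
  \<open>U\<^sub>t - c U\<^sub>x\<close> is constant along the characteristic \<open>x = \<xi> + c t\<close> for \<open>c = 1\<close> and for \<open>c = - 1\<close>. Together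
  the two give \<open>U\<^sub>x\<close> in terms of the initial data \<open>f\<close> and \<open>g\<close>, at all times, and the formula is
  differentiated three times in \<open>x\<close> and once more in \<open>t\<close>.
\<close>

lemma wave_trace_regular:
  assumes T: "0 < T" and U: "wave_solution T U"
  shows "\<exists>a' L. \<forall>t\<in>{0..T}. (Uxxxx_interface U has_real_derivative a' t) (at t within {0..T}) \<and>
    \<bar>Uxxxx_interface U t\<bar> \<le> L \<and> \<bar>a' t\<bar> \<le> L"
proof -
  obtain D :: "nat \<Rightarrow> nat \<Rightarrow> real \<Rightarrow> real \<Rightarrow> real" where D0: "D 0 0 = U"
    and Dx: "\<And>i j x t. i + j < 2 \<Longrightarrow> t \<in> {0..T} \<Longrightarrow>
      ((\<lambda>y. D i j y t) has_real_derivative D (i + 1) j x t) (at x)"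
    and Dt: "\<And>i j x t. i + j < 2 \<Longrightarrow> t \<in> {0..T} \<Longrightarrow>
      ((\<lambda>s. D i j x s) has_real_derivative D i (j + 1) x t) (at t within {0..T})"
    and cont: "\<And>i j. i + j \<le> 2 \<Longrightarrow> continuous_on (UNIV \<times> {0..T}) (\<lambda>(x, t). D i j x t)"
    and wave: "\<And>x t. t \<in> {0<..T} \<Longrightarrow> D 0 2 x t = D 2 0 x t"
    and smooth: "smooth (\<lambda>x. U x 0)" "smooth (\<lambda>x. D 0 1 x 0)"
    using U unfolding wave_solution_def by blast
  define f where "f n = (deriv ^^ n) (\<lambda>x. U x 0)" for n
  define g where "g n = (deriv ^^ n) (\<lambda>x. D 0 1 x 0)" for n
  have f: "(f n has_real_derivative f (Suc n) x) (at x)" and g: "(g n has_real_derivative g (Suc n) x) (at x)" for n x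
    unfolding f_def g_def by (rule smooth_has_derivative, rule smooth)+
  have f1: "D 1 0 x 0 = f 1 x" for x
  proof -
    have "((\<lambda>x. U x 0) has_real_derivative D 1 0 x 0) (at x)"
      using Dx[of 0 0 0 x] T D0 by simp
    then show ?thesis using f[of 0 x] by (simp add: f_def DERIV_unique)
  qed
  have characteristic: "D 0 1 (\<xi> + c * t) t - c * D 1 0 (\<xi> + c * t) t = g 0 \<xi> - c * f 1 \<xi>"
    if "c * c = 1" "t \<in> {0..T}" for c \<xi> t
  proof -
    define P where "P s = D 0 1 (\<xi> + c * s) s - c * D 1 0 (\<xi> + c * s) s" for s
    have P': "(P has_real_derivative D 0 2 (\<xi> + c * s) s - D 2 0 (\<xi> + c * s) s) (at s within {0..T})"
      if s: "s \<in> {0..T}" for s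
    proof -
      have "((\<lambda>s. D 0 1 (\<xi> + c * s) s) has_real_derivative
          c * D 1 1 (\<xi> + c * s) s + D 0 2 (\<xi> + c * s) s) (at s within {0..T})"
        using Dx[of 0 1] Dt[of 0 1] cont[of 1 1] s
        by (intro derivative_along_line) (auto simp: numeral_2_eq_2)
      moreover have "((\<lambda>s. D 1 0 (\<xi> + c * s) s) has_real_derivative
          c * D 2 0 (\<xi> + c * s) s + D 1 1 (\<xi> + c * s) s) (at s within {0..T})"
        using Dx[of 1 0] Dt[of 1 0] cont[of 2 0] s
        by (intro derivative_along_line) (auto simp: numeral_2_eq_2)
      ultimately have "(P has_real_derivative (c * D 1 1 (\<xi> + c * s) s + D 0 2 (\<xi> + c * s) s) -
          c * (c * D 2 0 (\<xi> + c * s) s + D 1 1 (\<xi> + c * s) s)) (at s within {0..T})"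
        unfolding P_def by (intro DERIV_diff DERIV_cmult)
      moreover have "c * (c * D 2 0 (\<xi> + c * s) s) = D 2 0 (\<xi> + c * s) s"
        using \<open>c * c = 1\<close> by (simp flip: mult.assoc)
      ultimately show ?thesis by (simp add: distrib_left)
    qed
    have "P t = P 0"
    proof (rule DERIV_isconst2[OF T])
      show "continuous_on {0..T} P" by (rule DERIV_continuous_on[OF P'])
      show "(P has_real_derivative 0) (at s)" if "0 < s" "s < T" for s
        using P'[of s] wave[of s] that by (simp add: at_within_Icc_at)
    qed (use \<open>t \<in> {0..T}\<close> in auto)
    then show ?thesis unfolding f1[symmetric] by (simp add: P_def g_def)
  qed
  define H where "H n t x = (f (Suc n) (x + t) + g n (x + t) - g n (x - t) + f (Suc n) (x - t)) / 2" for n t x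
  have U_x: "D 1 0 x t = H 0 t x" if "t \<in> {0..T}" for x t
  proof -
    have "D 0 1 x t - D 1 0 x t = g 0 (x - t) - f 1 (x - t)"
      using characteristic[of 1 t "x - t", OF _ that] by simp
    moreover have "D 0 1 x t + D 1 0 x t = g 0 (x + t) + f 1 (x + t)"
      using characteristic[of "- 1" t "x + t", OF _ that] by simp
    ultimately show ?thesis unfolding H_def by simp
  qed
  have shift: "((\<lambda>x. k (x + t)) has_real_derivative k' (x + t)) (at x)"
    "((\<lambda>x. k (x - t)) has_real_derivative k' (x - t)) (at x)"
    "((\<lambda>x. k (- x)) has_real_derivative - k' (- x)) (at x)"
    if "\<And>x. (k has_real_derivative k' x) (at x)" for k k' :: "real \<Rightarrow> real" and t x
  proof -
    show "((\<lambda>x. k (x + t)) has_real_derivative k' (x + t)) (at x)"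
      using that[of "x + t"] by (simp add: DERIV_shift)
    show "((\<lambda>x. k (x - t)) has_real_derivative k' (x - t)) (at x)"
      using that[of "x + (- t)"] unfolding DERIV_shift by simp
    show "((\<lambda>x. k (- x)) has_real_derivative - k' (- x)) (at x)"
      using that[of "- x"] unfolding DERIV_mirror .
  qed
  have H': "(H n t has_real_derivative H (Suc n) t x) (at x)" for n t x
    unfolding H_def
    by (intro DERIV_cdivide DERIV_add DERIV_diff shift(1,2)[OF f] shift(1,2)[OF g])
  have U_derivs: "(deriv ^^ Suc n) (\<lambda>x. U x t) = H n t" if "t \<in> {0..T}" for n t
  proof (induction n)
    case 0
    have "((\<lambda>x. U x t) has_real_derivative D 1 0 x t) (at x)" for x
      using Dx[of 0 0 t x] that D0 by simp
    then show ?case using U_x[OF that] by (simp add: fun_eq_iff DERIV_imp_deriv)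
  next
    case (Suc n)
    have "(deriv ^^ Suc (Suc n)) (\<lambda>x. U x t) = deriv (H n t)"
      unfolding Suc[symmetric] by simp
    also have "\<dots> = H (Suc n) t"
      by (rule ext, rule DERIV_imp_deriv, rule H')
    finally show ?case .
  qed
  define a where "a t = (f 4 t + g 3 t - g 3 (- t) + f 4 (- t)) / 2" for t
  define a' where "a' t = (f 5 t + g 4 t + g 4 (- t) - f 5 (- t)) / 2" for t
  have trace: "Uxxxx_interface U t = a t" if "t \<in> {0..T}" for t
  proof -
    have four: "(4::nat) = Suc 3" by simp
    show ?thesis
      unfolding Uxxxx_interface_def a_def four U_derivs[OF that] H_def by simp
  qed
  have f4: "(f 4 has_real_derivative f 5 x) (at x)" and g3: "(g 3 has_real_derivative g 4 x) (at x)" for x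
    using f[of 4 x] g[of 3 x] by simp_all
  have a': "(a has_real_derivative a' t) (at t within {0..T})" for t
  proof -
    have "((\<lambda>t. (f 4 t + g 3 t - g 3 (- t) + f 4 (- t)) / 2) has_real_derivative
        (f 5 t + g 4 t - - g 4 (- t) + - f 5 (- t)) / 2) (at t)"
      by (rule DERIV_cdivide DERIV_add DERIV_diff f4 g3 shift(3)[OF f4] shift(3)[OF g3])+
    then have "(a has_real_derivative a' t) (at t)"
      by (simp add: a_def[abs_def] a'_def)
    then show ?thesis by (rule DERIV_subset) simp
  qed
  have cont_fg: "continuous_on S (f n)" "continuous_on S (g n)" for S n
    by (rule DERIV_continuous_on[OF DERIV_subset[OF f subset_UNIV]]
        DERIV_continuous_on[OF DERIV_subset[OF g subset_UNIV]])+
  have "continuous_on {0..T} a'"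
    unfolding a'_def
    by (intro continuous_intros continuous_on_compose2[OF cont_fg(1)[of UNIV]] continuous_on_compose2[OF cont_fg(2)[of UNIV]]) auto
  then obtain L' where L': "\<And>t. t \<in> {0..T} \<Longrightarrow> \<bar>a' t\<bar> \<le> L'"
    using continuous_on_Icc_abs_bounded by blast
  have "continuous_on {0..T} a" by (rule DERIV_continuous_on[OF a'])
  then obtain L where L: "\<And>t. t \<in> {0..T} \<Longrightarrow> \<bar>a t\<bar> \<le> L"
    using continuous_on_Icc_abs_bounded by blast
  show ?thesis
  proof (intro exI ballI conjI)
    fix t assume t: "t \<in> {0..T}"
    show "(Uxxxx_interface U has_real_derivative a' t) (at t within {0..T})"
      by (rule has_field_derivative_transform_within[OF a' zero_less_one t]) (simp add: trace)
    show "\<bar>Uxxxx_interface U t\<bar> \<le> max L L'" "\<bar>a' t\<bar> \<le> max L L'"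
      using L[OF t] L'[OF t] by (simp_all add: trace[OF t])
  qed
qed

section \<open>Convergence of the error\<close>

lemma sq_upto_nonneg: "0 \<le> sq_upto N z"
  by (simp add: sq_upto_def sum_nonneg)

lemma sq_upto_cong: "(\<And>p. p \<in> nodes \<Longrightarrow> z p = w p) \<Longrightarrow> sq_upto N z = sq_upto N w"
  by (simp add: sq_upto_def block_sq_def)

lemma infsum_atLeast_1_tendsto:
  fixes f :: "nat \<Rightarrow> real"
  assumes "f summable_on {1..}"
  shows "(\<lambda>N. \<Sum>j=1..N. f j) \<longlonglongrightarrow> infsum f {1..}"
proof -
  have "(sum f \<longlongrightarrow> infsum f {1..}) (finite_subsets_at_top {1..})"
    using has_sum_infsum[OF assms] by (simp add: has_sum_def)
  moreover have "filterlim (\<lambda>N. {1..N}) (finite_subsets_at_top {1..}) sequentially"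
    unfolding filterlim_finite_subsets_at_top
  proof (intro allI impI)
    fix X :: "nat set" assume X: "finite X \<and> X \<subseteq> {1..}"
    have "\<forall>\<^sub>F N in sequentially. Max (insert 0 X) \<le> N" by (rule eventually_ge_at_top)
    then show "\<forall>\<^sub>F N in sequentially. finite {1..N} \<and> X \<subseteq> {1..N} \<and> {1..N} \<subseteq> {1..}"
      by eventually_elim (use X in auto)
  qed
  ultimately show ?thesis
    by (rule filterlim_compose)
qed

text \<open>
  The partial sums of the square of \<open>hnorm\<close>.
\<close>

definition hnorm_sq_upto :: "real \<Rightarrow> nat \<Rightarrow> grid_vec \<Rightarrow> real" where
  "hnorm_sq_upto h N z = h * (\<Sum>j=1..N. (z (FD j))\<^sup>2) + h / 4 * (\<Sum>j=1..N. \<Sum>i=1..4. (z (DG j i))\<^sup>2)"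

lemma hnorm_sq_upto_mono: "0 < h \<Longrightarrow> N \<le> N' \<Longrightarrow> hnorm_sq_upto h N z \<le> hnorm_sq_upto h N' z"
  unfolding hnorm_sq_upto_def by (intro add_mono mult_left_mono sum_mono2) (auto intro: sum_nonneg)

lemma hnorm_sq_upto_le_sq_upto: "0 < h \<Longrightarrow> hnorm_sq_upto h N z \<le> h * sq_upto N z"
proof -
  assume h: "0 < h"
  have "h / 4 * (\<Sum>j=1..N. \<Sum>i=1..4. (z (DG j i))\<^sup>2) \<le> h * (\<Sum>j=1..N. \<Sum>i=1..4. (z (DG j i))\<^sup>2)"
    using h by (intro mult_right_mono) (auto intro!: sum_nonneg)
  then show ?thesis by (simp add: hnorm_sq_upto_def sq_upto_def block_sq_def sum.distrib distrib_left)
qed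

lemma sq_upto_le_hnorm_sq_upto: "0 < h \<Longrightarrow> sq_upto N z \<le> 4 / h * hnorm_sq_upto h N z"
proof -
  assume h: "0 < h"
  have "4 / h * hnorm_sq_upto h N z = 4 * (\<Sum>j=1..N. (z (FD j))\<^sup>2) + (\<Sum>j=1..N. \<Sum>i=1..4. (z (DG j i))\<^sup>2)"
    using h by (simp add: hnorm_sq_upto_def distrib_left)
  moreover have "0 \<le> (\<Sum>j=1..N. (z (FD j))\<^sup>2)" by (simp add: sum_nonneg)
  ultimately show ?thesis by (simp add: sq_upto_def block_sq_def sum.distrib)
qed

lemma hnorm_sq_upto_tendsto:
  assumes h: "0 < h" and z: "(\<lambda>p. (z p)\<^sup>2) summable_on nodes"
  shows "(\<lambda>N. hnorm_sq_upto h N z) \<longlonglongrightarrow> (hnorm h z)\<^sup>2"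
proof -
  have FD: "(\<lambda>j. (z (FD j))\<^sup>2) summable_on {1..}"
  proof -
    have "(\<lambda>p. (z p)\<^sup>2) summable_on FD ` {1..}"
      by (rule summable_on_subset_banach[OF z]) auto
    then show ?thesis
      by (subst (asm) summable_on_reindex) (auto simp: inj_on_def o_def)
  qed
  have "(\<lambda>j. (z (DG j i))\<^sup>2) summable_on {1..}" if "i \<in> {1..4}" for i
  proof -
    have "(\<lambda>p. (z p)\<^sup>2) summable_on (\<lambda>j. DG j i) ` {1..}"
      by (rule summable_on_subset_banach[OF z]) (use that in auto)
    then show ?thesis
      by (subst (asm) summable_on_reindex) (auto simp: inj_on_def o_def)
  qed
  then have DG: "(\<lambda>j. \<Sum>i=1..4. (z (DG j i))\<^sup>2) summable_on {1..}"
    by (auto simp: numeral_eq_Suc intro!: summable_on_add)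
  have "0 \<le> h * (\<Sum>\<^sub>\<infinity>j\<in>{1..}. (z (FD j))\<^sup>2) + h / 4 * (\<Sum>\<^sub>\<infinity>j\<in>{1..}. \<Sum>i=1..4. (z (DG j i))\<^sup>2)"
    using h by (intro add_nonneg_nonneg mult_nonneg_nonneg infsum_nonneg sum_nonneg) auto
  then have eq: "(hnorm h z)\<^sup>2 =
      h * (\<Sum>\<^sub>\<infinity>j\<in>{1..}. (z (FD j))\<^sup>2) + h / 4 * (\<Sum>\<^sub>\<infinity>j\<in>{1..}. \<Sum>i=1..4. (z (DG j i))\<^sup>2)"
    by (simp add: hnorm_def)
  show ?thesis
    unfolding hnorm_sq_upto_def eq by (intro tendsto_add tendsto_mult_left infsum_atLeast_1_tendsto FD DG)
qed

text \<open>
  The first derivative of the error is obtained from its second derivative by integration; since the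
  equation is linear and the initial data vanish, this integrates the equation.
\<close>

lemma antiderivative_of_error:
  assumes T: "0 < T"
    and \<delta>: "\<And>t p. t \<in> {0..T} \<Longrightarrow> p \<in> nodes \<Longrightarrow> ((\<lambda>s. \<delta> s p) has_real_derivative \<delta>' t p) (at t within {0..T})"
    and \<delta>': "\<And>t p. t \<in> {0..T} \<Longrightarrow> p \<in> nodes \<Longrightarrow>
      ((\<lambda>s. \<delta>' s p) has_real_derivative Q h (\<delta> t) p + a t * \<tau> p) (at t within {0..T})"
    and \<delta>'0: "\<And>p. p \<in> nodes \<Longrightarrow> \<delta>' 0 p = 0"
    and a: "continuous_on {0..T} a"
    and t: "t \<in> {0..T}" and p: "p \<in> nodes"
  shows "((\<lambda>s. integral {0..s} (\<lambda>s. \<delta> s p)) has_real_derivative \<delta> t p) (at t within {0..T})"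
    and "\<delta>' t p = Q h (\<lambda>q. integral {0..t} (\<lambda>s. \<delta> s q)) p + integral {0..t} a * \<tau> p"
proof -
  have E: "((\<lambda>s. integral {0..s} (\<lambda>s. \<delta> s q)) has_real_derivative \<delta> s q) (at s within {0..T})"
    if "q \<in> nodes" "s \<in> {0..T}" for q s
    by (rule integral_has_real_derivative[OF DERIV_continuous_on[OF \<delta>]]) (use that in auto)
  show "((\<lambda>s. integral {0..s} (\<lambda>s. \<delta> s p)) has_real_derivative \<delta> t p) (at t within {0..T})"
    by (rule E[OF p t])
  define G where "G s = \<delta>' s p - (Q h (\<lambda>q. integral {0..s} (\<lambda>s. \<delta> s q)) p + integral {0..s} a * \<tau> p)" for s
  have G': "(G has_real_derivative 0) (at s within {0..T})" if s: "s \<in> {0..T}" for s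
  proof -
    have "(G has_real_derivative (Q h (\<delta> s) p + a s * \<tau> p) - (Q h (\<delta> s) p + a s * \<tau> p)) (at s within {0..T})"
      unfolding G_def
      by (intro DERIV_diff DERIV_add DERIV_cmult_right \<delta>'[OF s p] integral_has_real_derivative[OF a s]
          local_functional_has_derivative[OF local_functional_Q[OF p], where y = "\<lambda>s q. integral {0..s} (\<lambda>s. \<delta> s q)"] E s)
    then show ?thesis by simp
  qed
  have "G t = G 0"
  proof (rule DERIV_isconst2[OF T])
    show "continuous_on {0..T} G" by (rule DERIV_continuous_on[OF G'])
    show "(G has_real_derivative 0) (at s)" if "0 < s" "s < T" for s
      using G'[of s] that by (simp add: at_within_Icc_at)
  qed (use t in auto)
  moreover have "G 0 = 0"
    using \<delta>'0[OF p] local_functional_combination[OF local_functional_Q[OF p], of h 0 "\<lambda>p. 0" 0 "\<lambda>p. 0"]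
    by (simp add: G_def del: Q.simps)
  ultimately show "\<delta>' t p = Q h (\<lambda>q. integral {0..t} (\<lambda>s. \<delta> s q)) p + integral {0..t} a * \<tau> p"
    by (simp add: G_def del: Q.simps)
qed

text \<open>
  The constants of \<open>energy_estimate\<close> and of the inequality \<open>(a + b)\<^sup>2 \<le> 2 a\<^sup>2 + 2 b\<^sup>2\<close>, collected.
\<close>

definition growth :: "real \<Rightarrow> real" where
  "growth T = 226 + 896 * T\<^sup>2 * (1 + T\<^sup>2)"

text \<open>
  The power is 7 because \<open>sq_upto\<close> lacks the factor \<open>h\<close> of the squared norm.
\<close>

lemma error_bound:
  assumes T: "0 < T" and h: "0 < h"
    and sol: "error_solution h T a \<delta>"
    and a: "\<And>t. t \<in> {0..T} \<Longrightarrow> (a has_real_derivative a' t) (at t within {0..T})"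
    and L: "\<And>t. t \<in> {0..T} \<Longrightarrow> \<bar>a t\<bar> \<le> L" "\<And>t. t \<in> {0..T} \<Longrightarrow> \<bar>a' t\<bar> \<le> L"
    and \<phi>: "\<And>p. p \<in> nodes \<Longrightarrow> Q h \<phi> p = truncation 1 1 p / h\<^sup>2 + r p"
    and K: "\<And>N. sq_upto N \<phi> \<le> K / h" "\<And>N. sq_upto N r \<le> K / h"
    and t: "t \<in> {0..T}"
  shows "sq_upto N (\<delta> t) \<le> growth T * K * L\<^sup>2 * h ^ 7"
proof -
  obtain B where B: "\<And>t. t \<in> {0..T} \<Longrightarrow> (\<lambda>p. (\<delta> t p)\<^sup>2) summable_on nodes"
      "\<And>t. t \<in> {0..T} \<Longrightarrow> hnorm h (\<delta> t) \<le> B"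
    using sol unfolding error_solution_def by blast
  obtain \<delta>' where \<delta>0: "\<And>p. p \<in> nodes \<Longrightarrow> \<delta> 0 p = 0" "\<And>p. p \<in> nodes \<Longrightarrow> \<delta>' 0 p = 0"
    and \<delta>: "\<And>t p. t \<in> {0..T} \<Longrightarrow> p \<in> nodes \<Longrightarrow> ((\<lambda>s. \<delta> s p) has_real_derivative \<delta>' t p) (at t within {0..T})"
    and \<delta>': "\<And>t p. t \<in> {0..T} \<Longrightarrow> p \<in> nodes \<Longrightarrow>
      ((\<lambda>s. \<delta>' s p) has_real_derivative Q h (\<delta> t) p + truncation h (a t) p) (at t within {0..T})"
    using sol unfolding error_solution_def by blast
  define \<tau> where "\<tau> p = h\<^sup>2 * truncation 1 1 p" for p
  have \<delta>'\<tau>: "((\<lambda>s. \<delta>' s p) has_real_derivative Q h (\<delta> t) p + a t * \<tau> p) (at t within {0..T})"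
    if "t \<in> {0..T}" "p \<in> nodes" for t p
    using \<delta>'[OF that] unfolding truncation_scaling[of h "a t"] \<tau>_def by (simp only: mult_ac)
  have a_cont: "continuous_on {0..T} a" by (rule DERIV_continuous_on[OF a])
  define A where "A t = integral {0..t} a" for t
  have A': "(A has_real_derivative a t) (at t within {0..T})" if "t \<in> {0..T}" for t
    unfolding A_def by (rule integral_has_real_derivative[OF a_cont that])
  have L0: "0 \<le> L" using L(1)[of 0] T by auto
  have A: "\<bar>A t\<bar> \<le> T * L" if t: "t \<in> {0..T}" for t
  proof -
    have "norm (integral {0..t} a) \<le> integral {0..t} (\<lambda>_. L)"
      using t L(1) by (intro integral_norm_bound_integral integrable_continuous_interval
          continuous_on_subset[OF a_cont] continuous_on_const) auto
    then have "\<bar>A t\<bar> \<le> t * L" using t by (simp add: A_def)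
    also have "\<dots> \<le> T * L" using t L0 by (intro mult_right_mono) auto
    finally show ?thesis .
  qed
  define E where "E t p = integral {0..t} (\<lambda>s. \<delta> s p)" for t p
  have E: "((\<lambda>s. E s p) has_real_derivative \<delta> t p) (at t within {0..T})"
    "\<delta>' t p = Q h (E t) p + A t * \<tau> p" if "t \<in> {0..T}" "p \<in> nodes" for t p
    unfolding A_def E_def[abs_def]
    by (rule antiderivative_of_error[where \<delta> = \<delta> and \<delta>' = \<delta>' and a = a and \<tau> = \<tau> and h = h];
        (rule T \<delta> \<delta>'\<tau> \<delta>0 a_cont that | assumption)+)+
  define y where "y t p = E t p + h ^ 4 * A t * \<phi> p" for t p
  define v where "v t p = \<delta> t p + h ^ 4 * a t * \<phi> p" for t p
  define F where "F t p = h ^ 4 * a' t * \<phi> p + - (h ^ 4 * A t) * r p" for t p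
  have K0: "0 \<le> K / h" using K(1)[of 0] sq_upto_nonneg[of 0 \<phi>] by linarith
  define M where "M = h ^ 8 * L\<^sup>2 * (K / h)"
  \<comment> \<open>\<open>M\<close> bounds the squares of \<open>h ^ 4 * L * \<phi>\<close> and of \<open>h ^ 4 * L * r\<close>. This fact is applied to \<open>a\<close> and
    \<open>a'\<close> with \<open>d = 1\<close> and to \<open>A\<close> with \<open>d = T\<close>.\<close>
  have sq_a: "(h ^ 4 * c)\<^sup>2 * s \<le> b * M" if "\<bar>c\<bar> \<le> d * L" "s \<le> K / h" "0 \<le> s" "d\<^sup>2 = b" for b c d s
  proof -
    have "c\<^sup>2 \<le> (d * L)\<^sup>2" by (rule abs_le_square_iff[THEN iffD1]) (use that(1) in linarith)
    then have "(h ^ 4)\<^sup>2 * c\<^sup>2 * s \<le> (h ^ 4)\<^sup>2 * (d * L)\<^sup>2 * (K / h)"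
      using that by (intro mult_mono) auto
    then show ?thesis using that(4) by (simp add: M_def power_mult_distrib mult_ac flip: power_mult)
  qed
  have "sq_upto N (v t) \<le> 112 * M + 224 * T\<^sup>2 * (2 * M + 2 * (T\<^sup>2 * M))" if t: "t \<in> {0..T}" for N t
  proof (rule energy_estimate[OF h T, where y = y and v = v and F = F and B = "2 * (4 / h * B\<^sup>2) + 2 * M"])
    fix s p assume s: "s \<in> {0..T}" and p: "p \<in> nodes"
    show "((\<lambda>s. y s p) has_real_derivative v s p) (at s within {0..T})"
      unfolding y_def v_def by (intro DERIV_add E(1) DERIV_cmult_right DERIV_cmult A' s p)
    have "((\<lambda>s. v s p) has_real_derivative \<delta>' s p + h ^ 4 * a' s * \<phi> p) (at s within {0..T})"
      unfolding v_def by (intro DERIV_add \<delta> DERIV_cmult_right DERIV_cmult a s p)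
    moreover have "\<delta>' s p + h ^ 4 * a' s * \<phi> p = Q h (y s) p + F s p"
    proof -
      have "Q h (y s) p = Q h (E s) p + h ^ 4 * A s * Q h \<phi> p"
        using local_functional_combination[OF local_functional_Q[OF p], of h 1 "E s" "h ^ 4 * A s" \<phi>]
        by (simp add: y_def[abs_def] del: Q.simps)
      moreover have "h ^ 4 * A s * (truncation 1 1 p / h\<^sup>2) = A s * \<tau> p"
        using h by (simp add: \<tau>_def field_simps power2_eq_square numeral_eq_Suc)
      ultimately show ?thesis
        unfolding E(2)[OF s p] F_def \<phi>[OF p] by (simp add: distrib_left del: Q.simps)
    qed
    ultimately show "((\<lambda>s. v s p) has_real_derivative Q h (y s) p + F s p) (at s within {0..T})"
      by (simp only:)
  next
    fix p assume "p \<in> nodes"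
    then show "y 0 p = 0" by (simp add: y_def E_def A_def)
  next
    fix N s assume s: "s \<in> {0..T}"
    have "hnorm_sq_upto h N (\<delta> s) \<le> (hnorm h (\<delta> s))\<^sup>2"
      using hnorm_sq_upto_tendsto[OF h B(1)[OF s]] hnorm_sq_upto_mono[OF h]
      by (intro incseq_le) (auto simp: incseq_def)
    also have "\<dots> \<le> B\<^sup>2"
    proof (rule power_mono)
      show "0 \<le> hnorm h (\<delta> s)"
        unfolding hnorm_def using h
        by (intro real_sqrt_ge_zero add_nonneg_nonneg mult_nonneg_nonneg infsum_nonneg sum_nonneg) auto
    qed (rule B(2)[OF s])
    finally have "4 / h * hnorm_sq_upto h N (\<delta> s) \<le> 4 / h * B\<^sup>2" using h by (intro mult_left_mono) auto
    then have \<delta>B: "sq_upto N (\<delta> s) \<le> 4 / h * B\<^sup>2" using sq_upto_le_hnorm_sq_upto[OF h, of N "\<delta> s"] by linarith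
    have "sq_upto N (\<lambda>p. (h ^ 4 * a s) * \<phi> p) \<le> 1 * M"
      unfolding sq_upto_scale by (rule sq_a[of _ 1]) (use L(1)[OF s] K sq_upto_nonneg in auto)
    then show "sq_upto N (v s) \<le> 2 * (4 / h * B\<^sup>2) + 2 * M"
      using sq_upto_add[of N "\<delta> s" "\<lambda>p. (h ^ 4 * a s) * \<phi> p"] \<delta>B
      unfolding v_def by linarith
    have "sq_upto N (\<lambda>p. (h ^ 4 * a' s) * \<phi> p) \<le> 1 * M"
      unfolding sq_upto_scale by (rule sq_a[of _ 1]) (use L(2)[OF s] K sq_upto_nonneg in auto)
    moreover have "sq_upto N (\<lambda>p. (- (h ^ 4 * A s)) * r p) \<le> T\<^sup>2 * M"
      unfolding sq_upto_scale power2_minus by (rule sq_a[of _ T]) (use A[OF s] K sq_upto_nonneg in auto)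
    ultimately show "sq_upto N (F s) \<le> 2 * M + 2 * (T\<^sup>2 * M)"
      using sq_upto_add[of N "\<lambda>p. (h ^ 4 * a' s) * \<phi> p" "\<lambda>p. (- (h ^ 4 * A s)) * r p"]
      unfolding F_def by linarith
  next
    fix N
    have "sq_upto N (v 0) = sq_upto N (\<lambda>p. (h ^ 4 * a 0) * \<phi> p)"
      by (rule sq_upto_cong) (simp add: v_def \<delta>0)
    also have "\<dots> \<le> 1 * M"
      unfolding sq_upto_scale by (rule sq_a[of _ 1]) (use L(1)[of 0] T K sq_upto_nonneg in auto)
    finally show "sq_upto N (v 0) \<le> M" by simp
  qed (rule t)
  note v = this[OF t, of N]
  have "sq_upto N (\<lambda>p. (h ^ 4 * (- a t)) * \<phi> p) \<le> 1 * M"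
    unfolding sq_upto_scale by (rule sq_a[of _ 1]) (use L(1)[OF t] K sq_upto_nonneg in auto)
  moreover have "\<delta> t = (\<lambda>p. v t p + (h ^ 4 * (- a t)) * \<phi> p)" by (simp add: v_def)
  ultimately have "sq_upto N (\<delta> t) \<le> 2 * (112 * M + 224 * T\<^sup>2 * (2 * M + 2 * (T\<^sup>2 * M))) + 2 * M"
    using sq_upto_add[of N "v t" "\<lambda>p. (h ^ 4 * (- a t)) * \<phi> p"] v by simp
  also have "\<dots> = growth T * M" by (simp add: growth_def algebra_simps)
  also have "M = K * L\<^sup>2 * h ^ 7" using h by (simp add: M_def numeral_eq_Suc)
  finally show ?thesis by (simp add: mult_ac)
qed

text \<open>
  The squared norm is an increasing limit of continuous functions of time, hence integrable by
  monotone convergence.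
\<close>

lemma integral_hnorm_square:
  assumes h: "0 < h" and T: "0 < T" and sol: "error_solution h T a \<delta>"
    and X: "\<And>N t. t \<in> {0..T} \<Longrightarrow> sq_upto N (\<delta> t) \<le> X"
  shows "(\<lambda>t. (hnorm h (\<delta> t))\<^sup>2) integrable_on {0..T}"
    and "integral {0..T} (\<lambda>t. (hnorm h (\<delta> t))\<^sup>2) \<le> T * (h * X)"
proof -
  have summable: "(\<lambda>p. (\<delta> t p)\<^sup>2) summable_on nodes" if "t \<in> {0..T}" for t
    using sol that unfolding error_solution_def by blast
  obtain \<delta>' where \<delta>: "\<And>t p. t \<in> {0..T} \<Longrightarrow> p \<in> nodes \<Longrightarrow>
      ((\<lambda>s. \<delta> s p) has_real_derivative \<delta>' t p) (at t within {0..T})"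
    using sol unfolding error_solution_def by blast
  have cont: "continuous_on {0..T} (\<lambda>t. \<delta> t p)" if "p \<in> nodes" for p
    by (rule DERIV_continuous_on[OF \<delta>]) (use that in auto)
  have int: "(\<lambda>t. hnorm_sq_upto h N (\<delta> t)) integrable_on {0..T}" for N
    unfolding hnorm_sq_upto_def by (intro integrable_continuous_interval continuous_intros cont) auto
  have bound: "hnorm_sq_upto h N (\<delta> t) \<le> h * X" if "t \<in> {0..T}" for N t
    using hnorm_sq_upto_le_sq_upto[OF h, of N "\<delta> t"] mult_left_mono[OF X[OF that, of N], of h] h by linarith
  have hnorm_sq_upto_nonneg: "0 \<le> hnorm_sq_upto h N z" for N z
    unfolding hnorm_sq_upto_def using h by (intro add_nonneg_nonneg mult_nonneg_nonneg sum_nonneg) auto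
  have le: "integral {0..T} (\<lambda>t. hnorm_sq_upto h N (\<delta> t)) \<le> T * (h * X)" for N
  proof -
    have "integral {0..T} (\<lambda>t. hnorm_sq_upto h N (\<delta> t)) \<le> integral {0..T} (\<lambda>t. h * X)"
      using bound by (intro integral_le int integrable_const_ivl) auto
    then show ?thesis using T by (simp add: mult_ac)
  qed
  have "(\<lambda>t. (hnorm h (\<delta> t))\<^sup>2) integrable_on {0..T} \<and>
      (\<lambda>N. integral {0..T} (\<lambda>t. hnorm_sq_upto h N (\<delta> t))) \<longlonglongrightarrow> integral {0..T} (\<lambda>t. (hnorm h (\<delta> t))\<^sup>2)"
  proof (rule monotone_convergence_increasing)
    show "bounded (range (\<lambda>N. integral {0..T} (\<lambda>t. hnorm_sq_upto h N (\<delta> t))))"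
      unfolding bounded_iff
    proof (intro exI ballI)
      fix x assume "x \<in> range (\<lambda>N. integral {0..T} (\<lambda>t. hnorm_sq_upto h N (\<delta> t)))"
      then obtain N where x: "x = integral {0..T} (\<lambda>t. hnorm_sq_upto h N (\<delta> t))" by blast
      have "0 \<le> x" unfolding x using hnorm_sq_upto_nonneg int by (intro integral_nonneg) auto
      then show "norm x \<le> T * (h * X)" using le[of N] x by simp
    qed
  qed (use int hnorm_sq_upto_mono[OF h] hnorm_sq_upto_tendsto[OF h summable] in auto)
  then show "(\<lambda>t. (hnorm h (\<delta> t))\<^sup>2) integrable_on {0..T}"
    and "integral {0..T} (\<lambda>t. (hnorm h (\<delta> t))\<^sup>2) \<le> T * (h * X)"
    using le by (auto intro: LIMSEQ_le_const2)
qed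

text \<open>
  Stated as a property of the values on \<open>{0..T}\<close> alone, so that a choice of \<open>L\<close> can be a function of
  the restricted trace.
\<close>

definition derivative_bound :: "real \<Rightarrow> (real \<Rightarrow> real) \<Rightarrow> real \<Rightarrow> bool" where
  "derivative_bound T a L \<longleftrightarrow> (\<exists>a'. \<forall>t\<in>{0..T}.
    (a has_real_derivative a' t) (at t within {0..T}) \<and> \<bar>a t\<bar> \<le> L \<and> \<bar>a' t\<bar> \<le> L)"

lemma derivative_bound_restrict: "derivative_bound T (restrict a {0..T}) L \<longleftrightarrow> derivative_bound T a L"
proof -
  have "(restrict a {0..T} has_real_derivative D) (at t within {0..T}) \<longleftrightarrow>
      (a has_real_derivative D) (at t within {0..T})" if "t \<in> {0..T}" for t D
    by (rule has_field_derivative_cong_eventually)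
       (use that in \<open>auto simp: eventually_at_filter\<close>)
  then show ?thesis by (simp add: derivative_bound_def)
qed

theorem theorem3:
  shows "\<exists>C :: real \<Rightarrow> (real \<Rightarrow> real) \<Rightarrow> real.
    \<forall>(T::real) (U :: real \<Rightarrow> real \<Rightarrow> real) (h::real) (\<delta> :: real \<Rightarrow> grid_vec).
      0 < T \<longrightarrow> wave_solution T U \<longrightarrow> 0 < h \<longrightarrow>
      error_solution h T (Uxxxx_interface U) \<delta> \<longrightarrow>
        (\<lambda>t. (hnorm h (\<delta> t))\<^sup>2) integrable_on {0..T} \<and>
        sqrt (integral {0..T} (\<lambda>t. (hnorm h (\<delta> t))\<^sup>2))
          \<le> C T (restrict (Uxxxx_interface U) {0..T}) * h ^ 4"
proof -
  obtain K where K: "0 \<le> K" and corr: "\<And>h. 0 < h \<Longrightarrow> \<exists>\<phi> r.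
      (\<forall>p\<in>nodes. Q h \<phi> p = truncation 1 1 p / h\<^sup>2 + r p) \<and>
      (\<forall>N. sq_upto N \<phi> \<le> K / h) \<and> (\<forall>N. sq_upto N r \<le> K / h)"
    using corrector by blast
  define C where "C T a = sqrt (T * growth T * K) * (SOME L. derivative_bound T a L)" for T a
  show ?thesis
  proof (intro exI[of _ C] allI impI)
    fix T h :: real and U :: "real \<Rightarrow> real \<Rightarrow> real" and \<delta> :: "real \<Rightarrow> grid_vec"
    assume T: "0 < T" and U: "wave_solution T U" and h: "0 < h"
      and sol: "error_solution h T (Uxxxx_interface U) \<delta>"
    define a where "a = Uxxxx_interface U"
    define L where "L = (SOME L. derivative_bound T a L)"
    have "derivative_bound T a L"
      unfolding L_def using wave_trace_regular[OF T U]
      by (intro someI_ex[of "derivative_bound T a"]) (auto simp: derivative_bound_def a_def)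
    then obtain a' where a': "\<And>t. t \<in> {0..T} \<Longrightarrow> (a has_real_derivative a' t) (at t within {0..T})"
      and L: "\<And>t. t \<in> {0..T} \<Longrightarrow> \<bar>a t\<bar> \<le> L" "\<And>t. t \<in> {0..T} \<Longrightarrow> \<bar>a' t\<bar> \<le> L"
      unfolding derivative_bound_def by blast
    obtain \<phi> r where \<phi>: "\<And>p. p \<in> nodes \<Longrightarrow> Q h \<phi> p = truncation 1 1 p / h\<^sup>2 + r p"
      and sq: "\<And>N. sq_upto N \<phi> \<le> K / h" "\<And>N. sq_upto N r \<le> K / h"
      using corr[OF h] by blast
    define X where "X = growth T * K * L\<^sup>2 * h ^ 7"
    have "sq_upto N (\<delta> t) \<le> X" if "t \<in> {0..T}" for N t
      unfolding X_def by (rule error_bound[OF T h sol[folded a_def] a' L \<phi> sq that])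
    note int = integral_hnorm_square[OF h T sol this]
    have "0 \<le> L" using L(1)[of 0] T by auto
    have "T * (h * X) = (T * growth T * K) * (L * h ^ 4)\<^sup>2"
      by (simp add: X_def power_mult_distrib mult_ac numeral_eq_Suc)
    then have "sqrt (integral {0..T} (\<lambda>t. (hnorm h (\<delta> t))\<^sup>2)) \<le> sqrt ((T * growth T * K) * (L * h ^ 4)\<^sup>2)"
      using int(2) by (intro real_sqrt_le_mono) (simp only:)
    also have "\<dots> = sqrt (T * growth T * K) * (L * h ^ 4)"
      using \<open>0 \<le> L\<close> h by (simp add: real_sqrt_mult)
    also have "\<dots> = C T (restrict (Uxxxx_interface U) {0..T}) * h ^ 4"
      unfolding C_def derivative_bound_restrict L_def a_def by simp
    finally show "(\<lambda>t. (hnorm h (\<delta> t))\<^sup>2) integrable_on {0..T} \<and>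
        sqrt (integral {0..T} (\<lambda>t. (hnorm h (\<delta> t))\<^sup>2))
          \<le> C T (restrict (Uxxxx_interface U) {0..T}) * h ^ 4"
      using int(1) by blast
  qed
qed

end
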